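(* Let $X$ be a Banach space, $\mathcal{F}$ be a regular thin family with $\mathcal{F}\neq\{\varnothing\}$ and $L\in[\mathbb{N}]^\infty$. Let $(x_s)_{s\in\mathcal{F}\upharpoonright L}$ be an $\mathcal{F}$-subsequence in $X$ generating an $\mathcal{F}$-spreading model $(e_n)_n$. Also assume that $(x_s)_{s\in\mathcal{F}\upharpoonright L}$ is seminormalized, subordinated (with respect to the weak topology of $X$) and weakly null. Then $(e_n)_n$ is a $1$-unconditional spreading sequence.
   Context: $\mathbb{N}=\{1,2,\dots\}$. For $M\subseteq\mathbb{N}$, $[M]^{<\infty}$ and $[M]^\infty$ denote the sets of finite, respectively infinite, subsets of $M$. For $s\subseteq\mathbb{N}$, $s(k)$ is the $k$-th element of $s$ in increasing order and $|s|$ its cardinality. $t\sqsubseteq s$ means that $t$ is an initial segment of $s$. For $\mathcal{F}\subseteq[\mathbb{N}]^{<\infty}$, $\mathcal{F}\upharpoonright M=\mathcal{F}\cap[M]^{<\infty}$ and $\widehat{\mathcal{F}}=\{t\in[\mathbb{N}]^{<\infty}:\exists s\in\mathcal{F},\ t\sqsubseteq s\}$. A nonempty family $\mathcal{R}\subseteq[\mathbb{N}]^{<\infty}$ is regular if it is hereditary (closed under subsets), spreading (if $\{n_1<\dots<n_k\}\in\mathcal{R}$, $m_1<\dots<m_k$ and $n_i\leq m_i$ for all $i$, then $\{m_1,\dots,m_k\}\in\mathcal{R}$) and compact (the set of characteristic functions of its members is closed in $\{0,1\}^{\mathbb{N}}$). $\mathcal{F}$ is thin if no element of $\mathcal{F}$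 is a proper initial segment of another one. $\mathcal{F}$ is regular thin if it is thin and $\widehat{\mathcal{F}}$ is regular. A tuple $(s_j)_{j=1}^k$ of nonempty finite subsets of $\mathbb{N}$ is a plegma family if (i) $s_i(m)<s_j(m)$ whenever $i<j$ and $m\leq\min(|s_i|,|s_j|)$; and (ii) for all $i,j$, $s_i(m)<s_j(m+1)$ whenever $m\leq\min(|s_i|,|s_j|-1)$. $\mathrm{Plm}_k(\mathcal{F})$ is the set of all plegma families $(s_j)_{j=1}^k$ with all $s_j\in\mathcal{F}$. An $\mathcal{F}$-subsequence in $X$ is a map $\mathcal{F}\upharpoonright L\to X$, written $(x_s)_{s\in\mathcal{F}\upharpoonright L}$. Let $(E,\|\cdot\|_* )$ be an infinite dimensional seminormed linear space with Hamel basis $(e_n)_n$. $(x_s)_{s\in\mathcal{F}\upharpoonright L}$ generates $(e_n)_n$ as an $\mathcal{F}$-spreading model if there is a null sequence $(\delta_n)_n$ of positive reals such that for all $l\in\mathbb{N}$, $1\leq k\leq l$, $a_1,\dots,a_k\in[-1,1]$ and $(s_j)_{j=1}^k\in\mathrm{Plm}_k(\mathcal{F}\upharpoonright L)$ with $s_1(1)\geq L(l)$, $$\Big|\,\Big\|\sum_{j=1}^ka_jx_{s_j}\Big\|-\Big\|\sum_{j=1}^ka_je_j\Big\|_*\Big|\leq\delta_l.$$ Seminormalized: there are $0<c<C$ with $c\leq\|x_s\|\leq C$ for all $s$. Subordinated with respect to the weak topology: there is a continuous map $\widehat{\varphi}:\widehat{\mathcal{F}}\upharpoonright L\to(X,w)$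 with $\widehat{\varphi}(s)=x_s$ for $s\in\mathcal{F}\upharpoonright L$, where $\widehat{\mathcal{F}}\upharpoonright L$ is viewed as a subspace of $\{0,1\}^{\mathbb{N}}$ via characteristic functions. Weakly null: for every weakly open $U\ni0$ there is $m\in\mathbb{N}$ such that $x_s\in U$ for every $s\in\mathcal{F}\upharpoonright L$ with $\min s\geq L(m)$. A sequence $(e_n)_n$ is spreading if $\|\sum_{j=1}^na_je_j\|_*=\|\sum_{j=1}^na_je_{k_j}\|_*$ for all $n$, $k_1<\dots<k_n$ and reals $a_j$; it is $C$-unconditional if $\|\sum_{n\in F}a_ne_n\|_*\leq C\|\sum_{n=1}^ma_ne_n\|_*$ for all $m$, $F\subseteq\{1,\dots,m\}$ and reals $a_1,\dots,a_m$. *)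

theory Defs
  imports "HOL-Analysis.Analysis"
begin

definition PNat :: "nat set" where
  "PNat = {1..}"

definition fin_subsets :: "nat set \<Rightarrow> nat set set" where
  "fin_subsets M = {s. s \<subseteq> M \<and> finite s}"

definition inf_subsets :: "nat set \<Rightarrow> nat set set" where
  "inf_subsets M = {s. s \<subseteq> M \<and> infinite s}"

text \<open>The library function \<^const>\<open>enumerate\<close> counts from 0, here \<open>s(k)\<close> counts from 1. For
  finite \<open>s\<close> the value is meaningful only if \<open>1 \<le> k \<le> card s\<close>.\<close>

definition elt :: "nat set \<Rightarrow> nat \<Rightarrow> nat" where
  "elt s k = enumerate s (k - 1)"

definition initial_segment :: "nat set \<Rightarrow> nat set \<Rightarrow> bool" where
  "initial_segment t s \<longleftrightarrow> t \<subseteq> s \<and> (\<forall>x\<in>s. \<forall>y\<in>t. x \<le> y \<longrightarrow> x \<in> t)"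

definition restr :: "nat set set \<Rightarrow> nat set \<Rightarrow> nat set set" where
  "restr F M = F \<inter> fin_subsets M"

definition hat :: "nat set set \<Rightarrow> nat set set" where
  "hat F = {t \<in> fin_subsets PNat. \<exists>s\<in>F. initial_segment t s}"

definition cantor_space :: "(nat \<Rightarrow> nat) topology" where
  "cantor_space = product_topology (\<lambda>_. discrete_topology {0, 1}) PNat"

definition char_fun :: "nat set \<Rightarrow> nat \<Rightarrow> nat" where
  "char_fun s = restrict (indicator s) PNat"

definition hereditary :: "nat set set \<Rightarrow> bool" where
  "hereditary R \<longleftrightarrow> (\<forall>s\<in>R. \<forall>t. t \<subseteq> s \<longrightarrow> t \<in> R)"

definition spreading_family :: "nat set set \<Rightarrow> bool" where
  "spreading_family R \<longleftrightarrow>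
    (\<forall>s\<in>R. \<forall>t\<in>fin_subsets PNat.
       card t = card s \<and> (\<forall>i\<in>{1..card s}. elt s i \<le> elt t i) \<longrightarrow> t \<in> R)"

definition compact_family :: "nat set set \<Rightarrow> bool" where
  "compact_family R \<longleftrightarrow> closedin cantor_space (char_fun ` R)"

definition regular_family :: "nat set set \<Rightarrow> bool" where
  "regular_family R \<longleftrightarrow>
    R \<noteq> {} \<and> R \<subseteq> fin_subsets PNat \<and> hereditary R \<and> spreading_family R \<and> compact_family R"

definition thin :: "nat set set \<Rightarrow> bool" where
  "thin F \<longleftrightarrow> (\<forall>s\<in>F. \<forall>t\<in>F. initial_segment t s \<longrightarrow> t = s)"

definition regular_thin :: "nat set set \<Rightarrow> bool" where
  "regular_thin F \<longleftrightarrow> F \<subseteq> fin_subsets PNat \<and> thin F \<and> regular_family (hat F)"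

text \<open>A tuple \<open>(s\<^sub>1, \<dots>, s\<^sub>k)\<close> is an extensional function on \<open>{1..k}\<close>.\<close>

definition plegma :: "nat \<Rightarrow> (nat \<Rightarrow> nat set) \<Rightarrow> bool" where
  "plegma k s \<longleftrightarrow>
    (\<forall>j\<in>{1..k}. s j \<in> fin_subsets PNat \<and> s j \<noteq> {}) \<and>
    (\<forall>i\<in>{1..k}. \<forall>j\<in>{1..k}. i < j \<longrightarrow>
       (\<forall>m\<in>{1..min (card (s i)) (card (s j))}. elt (s i) m < elt (s j) m)) \<and>
    (\<forall>i\<in>{1..k}. \<forall>j\<in>{1..k}.
       (\<forall>m\<in>{1..min (card (s i)) (card (s j) - 1)}. elt (s i) m < elt (s j) (m + 1)))"

definition Plm :: "nat \<Rightarrow> nat set set \<Rightarrow> (nat \<Rightarrow> nat set) set" where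
  "Plm k F = {s \<in> {1..k} \<rightarrow>\<^sub>E F. plegma k s}"

definition seminorm :: "('e::real_vector \<Rightarrow> real) \<Rightarrow> bool" where
  "seminorm p \<longleftrightarrow>
    (\<forall>x. 0 \<le> p x) \<and> (\<forall>x y. p (x + y) \<le> p x + p y) \<and> (\<forall>c x. p (c *\<^sub>R x) = \<bar>c\<bar> * p x)"

text \<open>Sequences \<open>(e\<^sub>n)\<close> are indexed by \<open>n \<ge> 1\<close>; the value \<open>e 0\<close> is irrelevant.\<close>

definition hamel_basis :: "(nat \<Rightarrow> 'e::real_vector) \<Rightarrow> bool" where
  "hamel_basis e \<longleftrightarrow> inj_on e PNat \<and> independent (e ` PNat) \<and> span (e ` PNat) = UNIV"

text \<open>The seminormed space \<open>E\<close> is the type \<open>'e\<close> with seminorm \<open>p\<close>; it is infinite dimensional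
  because its Hamel basis is an injective sequence. An \<open>F\<close>-subsequence is a total function \<open>x\<close> of
  which only the values on \<open>restr F L\<close> matter.\<close>

definition generates_spreading_model ::
  "nat set set \<Rightarrow> nat set \<Rightarrow> (nat set \<Rightarrow> 'a::real_normed_vector) \<Rightarrow>
   ('e::real_vector \<Rightarrow> real) \<Rightarrow> (nat \<Rightarrow> 'e) \<Rightarrow> bool" where
  "generates_spreading_model F L x p e \<longleftrightarrow>
    seminorm p \<and> hamel_basis e \<and>
    (\<exists>\<delta>::nat \<Rightarrow> real. (\<forall>n. 0 < \<delta> n) \<and> \<delta> \<longlonglongrightarrow> 0 \<and>
      (\<forall>l\<ge>1. \<forall>k\<in>{1..l}. \<forall>a::nat \<Rightarrow> real. \<forall>s\<in>Plm k (restr F L).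
         (\<forall>j\<in>{1..k}. a j \<in> {-1..1}) \<and> elt (s 1) 1 \<ge> elt L l \<longrightarrow>
         \<bar>norm (\<Sum>j=1..k. a j *\<^sub>R x (s j)) - p (\<Sum>j=1..k. a j *\<^sub>R e j)\<bar> \<le> \<delta> l))"

definition weak_topology :: "'a::real_normed_vector topology" where
  "weak_topology = topology_generated_by
     {f -` U | (f :: 'a \<Rightarrow> real) U. bounded_linear f \<and> open U}"

definition seminormalized ::
  "nat set set \<Rightarrow> nat set \<Rightarrow> (nat set \<Rightarrow> 'a::real_normed_vector) \<Rightarrow> bool" where
  "seminormalized F L x \<longleftrightarrow>
    (\<exists>c C. 0 < c \<and> c < C \<and> (\<forall>s\<in>restr F L. c \<le> norm (x s) \<and> norm (x s) \<le> C))"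

definition subordinated ::
  "nat set set \<Rightarrow> nat set \<Rightarrow> (nat set \<Rightarrow> 'a::real_normed_vector) \<Rightarrow> bool" where
  "subordinated F L x \<longleftrightarrow>
    (\<exists>\<phi>. continuous_map (pullback_topology (restr (hat F) L) char_fun cantor_space)
            weak_topology \<phi> \<and>
         (\<forall>s\<in>restr F L. \<phi> s = x s))"

definition weakly_null ::
  "nat set set \<Rightarrow> nat set \<Rightarrow> (nat set \<Rightarrow> 'a::real_normed_vector) \<Rightarrow> bool" where
  "weakly_null F L x \<longleftrightarrow>
    (\<forall>U. openin weak_topology U \<and> 0 \<in> U \<longrightarrow>
       (\<exists>m\<ge>1. \<forall>s\<in>restr F L. Min s \<ge> elt L m \<longrightarrow> x s \<in> U))"

definition spreading_sequence :: "('e::real_vector \<Rightarrow> real) \<Rightarrow> (nat \<Rightarrow> 'e) \<Rightarrow> bool" where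
  "spreading_sequence p e \<longleftrightarrow>
    (\<forall>n\<ge>1. \<forall>k::nat \<Rightarrow> nat. \<forall>a::nat \<Rightarrow> real.
       k ` {1..n} \<subseteq> PNat \<and> strict_mono_on {1..n} k \<longrightarrow>
       p (\<Sum>j=1..n. a j *\<^sub>R e j) = p (\<Sum>j=1..n. a j *\<^sub>R e (k j)))"

definition unconditional :: "real \<Rightarrow> ('e::real_vector \<Rightarrow> real) \<Rightarrow> (nat \<Rightarrow> 'e) \<Rightarrow> bool" where
  "unconditional C p e \<longleftrightarrow>
    (\<forall>m\<ge>1. \<forall>F. \<forall>a::nat \<Rightarrow> real. F \<subseteq> {1..m} \<longrightarrow>
       p (\<Sum>n\<in>F. a n *\<^sub>R e n) \<le> C * p (\<Sum>n=1..m. a n *\<^sub>R e n))"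

end

theory Submission
  imports Defs
begin

text \<open>
  The subordinating map \<open>\<phi>\<close> is defined on the tree \<open>hat F\<close> restricted to \<open>L\<close>. Weak nullness
  forces \<open>\<phi> {} = 0\<close>, and weak continuity says that each nonterminal node \<open>t\<close> is the weak limit of
  its children: \<open>\<phi> (t \<union> {m}) \<rightarrow> \<phi> t\<close> as \<open>m \<rightarrow> \<infinity>\<close> in \<open>L\<close>. By Mazur's theorem \<open>\<phi> t\<close> is therefore a
  norm limit of convex combinations of the values at finitely many children with \<open>m\<close> as large as
  desired. Iterating down the tree, which is well founded because \<open>hat F\<close> is compact and consists
  of finite sets, puts \<open>0\<close> within any \<open>\<epsilon>\<close> of the convex hull of \<open>x ` T\<close> for a set \<open>T\<close> of members of
  \<open>F\<close> inside \<open>L\<close>.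

  For \<open>k\<close> such sets \<open>T 1, \<dots>, T k\<close> the process is run so that all \<open>(i+1)\<close>-st elements of sets
  in \<open>T j\<close> lie in the \<open>(i k + j)\<close>-th block of one fixed sequence of consecutive intervals. Then every
  choice of \<open>s j \<in> T j\<close> is a plegma family (lemma \<open>exists_interleaved_sets\<close>), so the
  spreading model norm estimates all of the corresponding linear combinations at once.

  Spreading follows by regarding a plegma family of length \<open>n\<close> as a subfamily of a longer one. For
  unconditionality it is enough to delete one coordinate \<open>q\<close>: fix \<open>s j \<in> T j\<close> for
  \<open>j \<noteq> q\<close>, put \<open>z = \<Sum>j\<noteq>q. a j x (s j)\<close>, and average over \<open>T q\<close>. All \<open>z + a q x t\<close> with \<open>t \<in> T q\<close> have
  norm at most \<open>p (\<Sum>j. a j e j) + \<epsilon>\<close>, hence so has \<open>z + a q y\<close> with \<open>y\<close> in the convex hull of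
  \<open>x ` T q\<close> and \<open>norm y < \<epsilon>\<close>; but \<open>norm z\<close> approximates the model norm of the
  combination without the coordinate \<open>q\<close>.

  Mazur's theorem rests on a Hahn--Banach theorem for sublinear functionals, obtained by showing
  that a minimal sublinear functional is linear.
\<close>

section \<open>Hahn--Banach separation and Mazur's theorem\<close>

text \<open>Asking for one inequality and positive scalars only keeps infima of sublinear functionals easy to
  recognise; homogeneity is recovered in \<open>sublinear_scale\<close>.\<close>

definition sublinear :: "('a::real_vector \<Rightarrow> real) \<Rightarrow> bool" where
  "sublinear q \<longleftrightarrow> (\<forall>x y. q (x + y) \<le> q x + q y) \<and> (\<forall>c>0. \<forall>x. q (c *\<^sub>R x) \<le> c * q x)"

lemma sublinear_add: "sublinear q \<Longrightarrow> q (x + y) \<le> q x + q y"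
  by (simp add: sublinear_def)

lemma sublinear_zero: assumes "sublinear q" shows "q 0 = 0"
proof -
  have "q (c *\<^sub>R 0) \<le> c * q 0" if "c > 0" for c
    using assms that unfolding sublinear_def by blast
  from this[of 2] this[of "1/2"] show ?thesis by simp
qed

lemma sublinear_scale:
  assumes "sublinear q" "0 \<le> c" shows "q (c *\<^sub>R x) = c * q x"
proof (cases "c = 0")
  case True then show ?thesis by (simp add: sublinear_zero[OF assms(1)])
next
  case False
  with assms have c: "c > 0" by simp
  have 1: "q (c *\<^sub>R x) \<le> c * q x" using assms c by (simp add: sublinear_def)
  have "q ((1/c) *\<^sub>R (c *\<^sub>R x)) \<le> (1/c) * q (c *\<^sub>R x)"
    using assms c unfolding sublinear_def by (metis zero_less_divide_1_iff)
  then have "c * q x \<le> q (c *\<^sub>R x)" using c by (simp add: field_simps)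
  with 1 show ?thesis by simp
qed

lemma sublinear_ge_neg: assumes "sublinear q" shows "- q (- x) \<le> q x"
  using sublinear_add[OF assms, of x "- x"] sublinear_zero[OF assms] by simp

text \<open>All sublinear functionals below are infima of this kind: of a chain, of a perturbation of a given
  functional, and of the functional that encodes the distance to a convex set. The hypotheses
  say that the sublinearity estimates hold up to a change of index.\<close>

lemma sublinear_INF:
  fixes g :: "'i \<Rightarrow> 'a::real_vector \<Rightarrow> real"
  assumes ne: "I \<noteq> {}"
    and bdd: "\<And>x. bdd_below ((\<lambda>i. g i x) ` I)"
    and add: "\<And>i j x y. i \<in> I \<Longrightarrow> j \<in> I \<Longrightarrow> \<exists>k\<in>I. g k (x + y) \<le> g i x + g j y"
    and scale: "\<And>i c x. i \<in> I \<Longrightarrow> c > 0 \<Longrightarrow> \<exists>k\<in>I. g k (c *\<^sub>R x) \<le> c * g i x"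
  shows "sublinear (\<lambda>x. INF i\<in>I. g i x)"
  unfolding sublinear_def
proof (intro conjI allI impI)
  let ?u = "\<lambda>x. INF i\<in>I. g i x"
  fix x y
  have "?u (x + y) \<le> g i x + g j y" if ij: "i \<in> I" "j \<in> I" for i j
  proof -
    obtain k where "k \<in> I" "g k (x + y) \<le> g i x + g j y" using add[OF ij] by blast
    then show ?thesis using cINF_lower[OF bdd \<open>k \<in> I\<close>] by (meson order_trans)
  qed
  then have "?u (x + y) - g i x \<le> g j y" if "i \<in> I" "j \<in> I" for i j
    using that by (simp add: diff_le_eq add.commute)
  then have "?u (x + y) - g i x \<le> ?u y" if "i \<in> I" for i
    by (intro cINF_greatest[OF ne]) (use that in blast)
  then have "?u (x + y) - ?u y \<le> g i x" if "i \<in> I" for i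
    using that by (simp add: diff_le_eq add.commute)
  then have "?u (x + y) - ?u y \<le> ?u x"
    by (intro cINF_greatest[OF ne])
  then show "?u (x + y) \<le> ?u x + ?u y" by simp
next
  let ?u = "\<lambda>x. INF i\<in>I. g i x"
  fix c :: real and x assume c: "c > 0"
  have "?u (c *\<^sub>R x) / c \<le> g i x" if i: "i \<in> I" for i
  proof -
    obtain k where "k \<in> I" "g k (c *\<^sub>R x) \<le> c * g i x" using scale[OF i c] by blast
    then have "?u (c *\<^sub>R x) \<le> c * g i x" using cINF_lower[OF bdd \<open>k \<in> I\<close>] by (meson order_trans)
    then show ?thesis using c by (simp add: field_simps)
  qed
  then have "?u (c *\<^sub>R x) / c \<le> ?u x" by (intro cINF_greatest[OF ne])
  then show "?u (c *\<^sub>R x) \<le> c * ?u x" using c by (simp add: field_simps)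
qed

text \<open>Zorn's lemma for the reversed pointwise order. A chain has a lower bound since any
  \<open>m \<le> q\<close> satisfies \<open>- q (- x) \<le> - m (- x) \<le> m x\<close>.\<close>

lemma exists_minimal_sublinear:
  assumes q: "sublinear q"
  obtains m where "sublinear m" "\<And>x. m x \<le> q x"
    "\<And>m'. sublinear m' \<Longrightarrow> (\<And>x. m' x \<le> m x) \<Longrightarrow> m' = m"
proof -
  define A where "A = {m. sublinear m \<and> m \<le> q}"
  have "\<exists>m\<in>A. \<forall>a\<in>A. m \<ge> a \<longrightarrow> a = m"
  proof (rule predicate_Zorn)
    show "partial_order_on A (relation_of (\<ge>) A)"
      by (rule partial_order_on_relation_ofI) auto
  next
    fix C assume C: "C \<in> Chains (relation_of (\<ge>) A)"
    have CA: "C \<subseteq> A" and chain: "\<And>a b. a \<in> C \<Longrightarrow> b \<in> C \<Longrightarrow> a \<le> b \<or> b \<le> a"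
      using C unfolding Chains_def relation_of_def by auto
    show "\<exists>u\<in>A. \<forall>a\<in>C. a \<ge> u"
    proof (cases "C = {}")
      case True then show ?thesis using q by (auto simp: A_def)
    next
      case False
      have bdd: "bdd_below ((\<lambda>m. m x) ` C)" for x
      proof (rule bdd_belowI2)
        fix m assume "m \<in> C"
        then have m: "sublinear m" "m \<le> q" using CA by (auto simp: A_def)
        have "m (-x) \<le> q (-x)" using m(2) by (simp add: le_fun_def)
        then show "- q (- x) \<le> m x" using sublinear_ge_neg[OF m(1), of x] by linarith
      qed
      define u where "u = (\<lambda>x. INF m\<in>C. m x)"
      have "sublinear u" unfolding u_def
      proof (rule sublinear_INF[OF False bdd])
        fix m n x y assume mn: "m \<in> C" "n \<in> C"
        have sub: "sublinear m" "sublinear n" using mn CA by (auto simp: A_def)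
        consider "m \<le> n" | "n \<le> m" using chain mn by blast
        then show "\<exists>k\<in>C. k (x + y) \<le> m x + n y"
        proof cases
          case 1
          then have "m (x + y) \<le> m x + n y"
            using sublinear_add[OF sub(1), of x y] le_funD[of m n y] by simp
          then show ?thesis using mn by blast
        next
          case 2
          then have "n (x + y) \<le> m x + n y"
            using sublinear_add[OF sub(2), of x y] le_funD[of n m x] by simp
          then show ?thesis using mn by blast
        qed
      next
        fix m and c :: real and x assume "m \<in> C" "c > 0"
        then show "\<exists>k\<in>C. k (c *\<^sub>R x) \<le> c * m x" using CA by (auto simp: A_def sublinear_def)
      qed
      moreover have le: "u \<le> a" if "a \<in> C" for a
        unfolding u_def le_fun_def using cINF_lower[OF bdd that] by blast
      moreover have "u \<le> q"
      proof -
        obtain a where a: "a \<in> C" using False by blast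
        then have "a \<le> q" using CA by (auto simp: A_def)
        then show ?thesis using le[OF a] by simp
      qed
      ultimately show ?thesis by (auto simp: A_def)
    qed
  qed
  then obtain m where m: "m \<in> A" "\<forall>a\<in>A. a \<le> m \<longrightarrow> a = m" by auto
  show ?thesis
  proof (rule that)
    show "sublinear m" "m x \<le> q x" for x using m by (auto simp: A_def le_fun_def)
    fix m' assume "sublinear m'" "\<And>x. m' x \<le> m x"
    moreover from this have "m' \<le> m" by (simp add: le_fun_def)
    moreover from this have "m' \<le> q" using m(1) order_trans[of m' m q] by (simp add: A_def)
    ultimately have "m' \<le> m" "m' \<in> A" by (simp_all add: A_def)
    then show "m' = m" using m by blast
  qed
qed

text \<open>A minimal sublinear \<open>m\<close> below \<open>q\<close> is linear. Pushing along a direction \<open>y\<close> gives the sublinear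
  functional \<open>inf {m (x + t y) - t m y | t \<ge> 0} \<le> m\<close>, which by minimality is \<open>m\<close> itself; its value at
  \<open>- y\<close>, estimated with \<open>t = 1\<close>, yields \<open>m (- y) \<le> - m y\<close>. An odd sublinear functional is additive.\<close>

theorem hahn_banach_sublinear:
  assumes q: "sublinear q"
  obtains f where "linear f" "\<And>x. f x \<le> q x"
proof -
  obtain m where m: "sublinear m" "\<And>x. m x \<le> q x"
    "\<And>m'. sublinear m' \<Longrightarrow> (\<And>x. m' x \<le> m x) \<Longrightarrow> m' = m"
    using exists_minimal_sublinear[OF q] by blast
  have neg: "m (- y) \<le> - m y" for y
  proof -
    define g where "g = (\<lambda>t x. m (x + t *\<^sub>R y) - t * m y)"
    have bdd: "bdd_below ((\<lambda>t. g t x) ` {0..})" for x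
    proof (rule bdd_belowI2)
      fix t :: real assume "t \<in> {0..}"
      then have "t * m y = m (t *\<^sub>R y)" by (simp add: sublinear_scale[OF m(1)])
      also have "\<dots> \<le> m (x + t *\<^sub>R y) + m (- x)"
        using sublinear_add[OF m(1), of "x + t *\<^sub>R y" "- x"] by simp
      finally show "- m (- x) \<le> g t x" by (simp add: g_def)
    qed
    define m' where "m' = (\<lambda>x. INF t\<in>{0..}. g t x)"
    have "sublinear m'" unfolding m'_def
    proof (rule sublinear_INF[OF _ bdd])
      show "{0::real..} \<noteq> {}" by auto
    next
      fix s t :: real and x z assume st: "s \<in> {0..}" "t \<in> {0..}"
      have "m ((x + s *\<^sub>R y) + (z + t *\<^sub>R y)) \<le> m (x + s *\<^sub>R y) + m (z + t *\<^sub>R y)"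
        by (rule sublinear_add[OF m(1)])
      then have "g (s + t) (x + z) \<le> g s x + g t z" by (simp add: g_def algebra_simps)
      then show "\<exists>k\<in>{0..}. g k (x + z) \<le> g s x + g t z" using st by (intro bexI[of _ "s + t"]) auto
    next
      fix t c :: real and x assume t: "t \<in> {0..}" and c: "c > 0"
      have "m (c *\<^sub>R (x + t *\<^sub>R y)) = c * m (x + t *\<^sub>R y)" using sublinear_scale[OF m(1)] c by simp
      then have "g (c * t) (c *\<^sub>R x) \<le> c * g t x" by (simp add: g_def algebra_simps)
      then show "\<exists>k\<in>{0..}. g k (c *\<^sub>R x) \<le> c * g t x" using t c by (intro bexI[of _ "c * t"]) auto
    qed
    moreover have "m' x \<le> g t x" if "t \<ge> 0" for t x
      unfolding m'_def by (rule cINF_lower[OF bdd]) (use that in simp)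
    note le = this
    have "m' x \<le> m x" for x using le[of 0 x] by (simp add: g_def)
    ultimately have "m' = m" by (rule m(3))
    then have "m (- y) \<le> g 1 (- y)" using le[of 1 "- y"] by simp
    then show ?thesis by (simp add: g_def sublinear_zero[OF m(1)])
  qed
  have odd: "m (- y) = - m y" for y using neg[of y] sublinear_ge_neg[OF m(1), of "-y"] by simp
  have "linear m"
  proof (rule linearI)
    fix x y
    have "- m (x + y) \<le> - m x + - m y"
      using sublinear_add[OF m(1), of "- x" "- y"] odd by (metis minus_add_distrib)
    then show "m (x + y) = m x + m y" using sublinear_add[OF m(1), of x y] by simp
  next
    fix c x
    show "m (c *\<^sub>R x) = c *\<^sub>R m x"
    proof (cases "c \<ge> 0")
      case True then show ?thesis by (simp add: sublinear_scale[OF m(1)])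
    next
      case False
      then have "m ((- c) *\<^sub>R x) = - c * m x" by (intro sublinear_scale[OF m(1)]) simp
      then show ?thesis using odd[of "c *\<^sub>R x"] by simp
    qed
  qed
  then show ?thesis using m(2) that by blast
qed

text \<open>Hahn--Banach applied to \<open>inf {norm (x + t c) - t d | t \<ge> 0, c \<in> C}\<close>. It is at most \<open>norm x\<close> (take
  \<open>t = 0\<close>), which makes the functional bounded, and at most \<open>- d\<close> at \<open>- c\<close> (take \<open>t = 1\<close>), which
  gives the separation.\<close>

lemma functional_separating_convex_from_zero:
  fixes C :: "'a::real_normed_vector set"
  assumes "convex C" and ne: "C \<noteq> {}" and d: "\<And>c. c \<in> C \<Longrightarrow> d \<le> norm c"
  obtains f :: "'a \<Rightarrow> real" where "bounded_linear f" "\<And>c. c \<in> C \<Longrightarrow> d \<le> f c"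
proof -
  \<comment> \<open>The pair \<open>i\<close> holds the scalar \<open>t\<close> and the point \<open>c\<close>.\<close>
  define g :: "real \<times> 'a \<Rightarrow> 'a \<Rightarrow> real" where "g = (\<lambda>i x. norm (x + fst i *\<^sub>R snd i) - fst i * d)"
  define I where "I = {0::real..} \<times> C"
  have "I \<noteq> {}" using ne by (auto simp: I_def)
  have bdd: "bdd_below ((\<lambda>i. g i x) ` I)" for x
  proof (rule bdd_belowI2)
    fix i assume i: "i \<in> I"
    then have "fst i * d \<le> fst i * norm (snd i)" using d by (intro mult_left_mono) (auto simp: I_def)
    also have "\<dots> = norm (fst i *\<^sub>R snd i)" using i by (auto simp: I_def)
    also have "\<dots> \<le> norm (x + fst i *\<^sub>R snd i) + norm x"
      using norm_triangle_ineq4[of "x + fst i *\<^sub>R snd i" x] by simp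
    finally show "- norm x \<le> g i x" by (simp add: g_def)
  qed
  define q where "q = (\<lambda>x. INF i\<in>I. g i x)"
  have "sublinear q" unfolding q_def
  proof (rule sublinear_INF[OF \<open>I \<noteq> {}\<close> bdd])
    fix i j x y assume ij: "i \<in> I" "j \<in> I"
    obtain s a t b where st: "i = (s, a)" "j = (t, b)" "s \<ge> 0" "t \<ge> 0" "a \<in> C" "b \<in> C"
      using ij by (auto simp: I_def)
    obtain c where c: "c \<in> C" "(s + t) *\<^sub>R c = s *\<^sub>R a + t *\<^sub>R b"
    proof (cases "s + t = 0")
      case True then have "s = 0" "t = 0" using st by auto
      then show ?thesis using st that[of a] by simp
    next
      case False
      then have "s + t > 0" using st by simp
      then have "(s/(s+t)) *\<^sub>R a + (t/(s+t)) *\<^sub>R b \<in> C"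
        using st by (intro convexD[OF \<open>convex C\<close>]) (auto simp: add_divide_distrib[symmetric])
      then show ?thesis using that \<open>s + t > 0\<close> by (simp add: scaleR_add_right)
    qed
    have "norm ((x + s *\<^sub>R a) + (y + t *\<^sub>R b)) \<le> norm (x + s *\<^sub>R a) + norm (y + t *\<^sub>R b)"
      by (rule norm_triangle_ineq)
    moreover have "(x + s *\<^sub>R a) + (y + t *\<^sub>R b) = x + y + (s + t) *\<^sub>R c" using c by simp
    ultimately have "g (s + t, c) (x + y) \<le> g i x + g j y"
      by (simp add: g_def st algebra_simps)
    then show "\<exists>k\<in>I. g k (x + y) \<le> g i x + g j y"
      using c st by (intro bexI[of _ "(s + t, c)"]) (auto simp: I_def)
  next
    fix i x and r :: real assume i: "i \<in> I" and r: "r > 0"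
    obtain s a where s: "i = (s, a)" "s \<ge> 0" "a \<in> C" using i by (auto simp: I_def)
    have "norm (r *\<^sub>R (x + s *\<^sub>R a)) = r * norm (x + s *\<^sub>R a)" using r by simp
    then have "g (r * s, a) (r *\<^sub>R x) \<le> r * g i x" by (simp add: g_def s algebra_simps)
    then show "\<exists>k\<in>I. g k (r *\<^sub>R x) \<le> r * g i x"
      using s r by (intro bexI[of _ "(r * s, a)"]) (auto simp: I_def)
  qed
  then obtain f where f: "linear f" "\<And>x. f x \<le> q x" using hahn_banach_sublinear by blast
  have qle: "q x \<le> g i x" if "i \<in> I" for i x
    unfolding q_def by (rule cINF_lower[OF bdd that])
  have fn: "f x \<le> norm x" for x
  proof -
    obtain c where "c \<in> C" using ne by blast
    then have "q x \<le> norm x" using qle[of "(0, c)" x] by (auto simp: I_def g_def)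
    then show ?thesis using f(2)[of x] by linarith
  qed
  have "bounded_linear f"
  proof (rule bounded_linear_intro[where K = 1])
    show "f (x + y) = f x + f y" "f (r *\<^sub>R x) = r *\<^sub>R f x" for x y r
      using f(1) by (auto simp: linear_add linear_scale)
    show "norm (f x) \<le> norm x * 1" for x
      using fn[of x] fn[of "- x"] linear_neg[OF f(1), of x] by simp
  qed
  moreover have "d \<le> f c" if "c \<in> C" for c
  proof -
    have "f (- c) \<le> g (1, c) (- c)" 
      using order_trans[OF f(2) qle[of "(1, c)"]] that by (simp add: I_def)
    then show ?thesis using linear_neg[OF f(1), of c] by (simp add: g_def)
  qed
  ultimately show ?thesis using that by blast
qed

text \<open>Mazur's theorem. A functional that separates \<open>v\<close> from the convex hull of \<open>S\<close> would contradict
  the weak approximation; passing to a finite subset is part of the statement because the later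
  construction has to leave room beyond all sets chosen so far.\<close>

lemma weak_limit_in_closure_convex_hull:
  fixes v :: "'a::real_normed_vector"
  assumes weak: "\<And>f \<epsilon>. bounded_linear (f :: 'a \<Rightarrow> real) \<Longrightarrow> \<epsilon> > 0 \<Longrightarrow> \<exists>s\<in>S. \<bar>f s - f v\<bar> < \<epsilon>"
    and "\<epsilon> > 0"
  obtains S0 y where "finite S0" "S0 \<subseteq> S" "y \<in> convex hull S0" "dist y v < \<epsilon>"
proof -
  define C where "C = (\<lambda>y. y - v) ` (convex hull S)"
  have "\<exists>c\<in>C. norm c < \<epsilon>"
  proof (rule ccontr)
    assume "\<not> ?thesis"
    then have far: "\<epsilon> \<le> norm c" if "c \<in> C" for c using that by force
    have "convex C" unfolding C_def using convex_translation[OF convex_convex_hull, of "- v" S]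
      by simp
    have "S \<noteq> {}" using weak[of "\<lambda>_. 0" 1] by auto
    then have "C \<noteq> {}" by (simp add: C_def)
    obtain f :: "'a \<Rightarrow> real" where f: "bounded_linear f" "\<And>c. c \<in> C \<Longrightarrow> \<epsilon> \<le> f c"
      using functional_separating_convex_from_zero[OF \<open>convex C\<close> \<open>C \<noteq> {}\<close> far] by blast
    obtain s where s: "s \<in> S" "\<bar>f s - f v\<bar> < \<epsilon>" using weak[OF f(1) \<open>\<epsilon> > 0\<close>] by blast
    then have "\<epsilon> \<le> f (s - v)" by (intro f(2)) (auto simp: C_def hull_inc)
    then show False using s(2) bounded_linear.linear[OF f(1)] by (simp add: linear_diff)
  qed
  then obtain y where y: "y \<in> convex hull S" "norm (y - v) < \<epsilon>" by (auto simp: C_def)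
  then obtain S0 u where "finite S0" "S0 \<subseteq> S" "\<forall>x\<in>S0. 0 \<le> u x" "sum u S0 = 1"
    "(\<Sum>x\<in>S0. u x *\<^sub>R x) = y" unfolding convex_hull_explicit by blast
  then show ?thesis
    by (intro that[of S0 y]) (use y(2) in \<open>auto simp: convex_hull_finite dist_norm\<close>)
qed

section \<open>The tree of a regular thin family\<close>

lemma elt_mem: "finite s \<Longrightarrow> i < card s \<Longrightarrow> elt s (Suc i) \<in> s"
  by (simp add: elt_def finite_enumerate_in_set)

lemma elt_surj: "finite s \<Longrightarrow> y \<in> s \<Longrightarrow> \<exists>i<card s. elt s (Suc i) = y"
  by (simp add: elt_def finite_enumerate_Ex)

lemma elt_insert_max:
  assumes "finite t" and m: "\<And>y. y \<in> t \<Longrightarrow> y < m"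
  shows "i < card t \<Longrightarrow> elt (insert m t) (Suc i) = elt t (Suc i)"
    and "elt (insert m t) (Suc (card t)) = m"
proof -
  let ?s = "insert m t"
  have "m \<notin> t" using m by blast
  then have card: "card ?s = Suc (card t)" using assms by simp
  have cut: "?s \<inter> {..<m} = t" using m by auto
  have eq: "elt ?s (Suc i) = elt t (Suc i)" if "i < card t" for i
    using finite_enumerate_initial_segment[of ?s i m] that assms(1) unfolding cut by (simp add: elt_def)
  then show "i < card t \<Longrightarrow> elt ?s (Suc i) = elt t (Suc i)" .
  obtain i where i: "i < card ?s" "elt ?s (Suc i) = m" using elt_surj[of ?s m] assms(1) by auto
  moreover have "\<not> i < card t" using i eq[of i] elt_mem[of t i] \<open>m \<notin> t\<close> assms(1) by auto
  ultimately have "i = card t" using card by simp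
  with i show "elt ?s (Suc (card t)) = m" by simp
qed

lemma char_fun_inj:
  assumes "s \<subseteq> PNat" "t \<subseteq> PNat" "char_fun s = char_fun t"
  shows "s = t"
proof -
  have val: "n \<in> u \<longleftrightarrow> char_fun u n = 1" if "n \<in> PNat" for u n
  proof -
    have "char_fun u n = indicator u n" unfolding char_fun_def by (rule restrict_apply'[OF that])
    then show ?thesis by (simp add: indicator_def)
  qed
  have "n \<in> s \<longleftrightarrow> n \<in> t" if "n \<in> PNat" for n
    unfolding val[OF that] assms(3) by (rule refl)
  then show ?thesis using assms(1,2) by blast
qed

lemma char_fun_in_cantor_space: "char_fun s \<in> topspace cantor_space"
  by (auto simp: char_fun_def cantor_space_def topspace_product_topology indicator_def)

text \<open>An infinite strictly increasing chain in \<open>R\<close> converges in the Cantor space to its union, which is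
  infinite and hence not a member of \<open>R\<close>, against compactness.\<close>

lemma wf_compact_family:
  assumes comp: "compact_family R" and fin: "R \<subseteq> fin_subsets PNat"
  shows "wf {(s, t). s \<in> R \<and> t \<in> R \<and> t \<subset> s}"
  unfolding wf_iff_no_infinite_down_chain
proof
  assume "\<exists>f. \<forall>i. (f (Suc i), f i) \<in> {(s, t). s \<in> R \<and> t \<in> R \<and> t \<subset> s}"
  then obtain f where f: "\<And>i. f i \<in> R" "\<And>i. f i \<subset> f (Suc i)"
    by (metis (mono_tags, lifting) case_prodD mem_Collect_eq)
  define U where "U = (\<Union>i. f i)"
  have ffin: "finite (f i)" "f i \<subseteq> PNat" for i using f(1)[of i] fin by (auto simp: fin_subsets_def)
  have mono: "i \<le> j \<Longrightarrow> f i \<subseteq> f j" for i j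
    by (rule lift_Suc_mono_le) (use f(2) in auto)
  have "i \<le> card (f i)" for i
  proof (induction i)
    case (Suc i)
    then show ?case using psubset_card_mono[OF ffin(1) f(2), of i] by simp
  qed simp
  moreover have "card (f i) \<le> card U" if "finite U" for i
    using that by (intro card_mono) (auto simp: U_def)
  ultimately have "infinite U" by (meson Suc_n_not_le_n order_trans)
  have "limitin cantor_space (\<lambda>i. char_fun (f i)) (char_fun U) sequentially"
    unfolding cantor_space_def limitin_componentwise
  proof (intro conjI ballI)
    show "char_fun U \<in> extensional PNat" by (simp add: char_fun_def)
    show "\<forall>\<^sub>F i in sequentially. char_fun (f i) \<in> topspace (product_topology (\<lambda>_. discrete_topology {0, 1}) PNat)"
      using char_fun_in_cantor_space by (simp add: cantor_space_def)
    fix n assume n: "n \<in> PNat"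
    have "\<forall>\<^sub>F i in sequentially. char_fun (f i) n = char_fun U n"
    proof (cases "n \<in> U")
      case True
      then obtain i0 where "n \<in> f i0" by (auto simp: U_def)
      then have "n \<in> f i" if "i \<ge> i0" for i using mono[OF that] by blast
      then show ?thesis using True
        by (auto simp: eventually_sequentially char_fun_def indicator_def restrict_def)
    next
      case False
      then show ?thesis by (auto simp: U_def char_fun_def restrict_def)
    qed
    then show "limitin (discrete_topology {0, 1}) (\<lambda>i. char_fun (f i) n) (char_fun U n) sequentially"
      using n by (intro limitin_eventually) (auto simp: char_fun_def indicator_def)
  qed
  then have "char_fun U \<in> char_fun ` R"
    by (rule limitin_closedin) (use comp f(1) in \<open>auto simp: compact_family_def\<close>)
  then obtain r where r: "r \<in> R" "char_fun U = char_fun r" by auto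
  have "U \<subseteq> PNat" using ffin by (auto simp: U_def)
  moreover have "r \<subseteq> PNat" using r(1) fin by (auto simp: fin_subsets_def)
  ultimately have "U = r" using r(2) char_fun_inj by blast
  then show False using r(1) fin \<open>infinite U\<close> by (auto simp: fin_subsets_def)
qed

lemma regular_thinD:
  assumes "regular_thin F"
  shows "F \<subseteq> fin_subsets PNat" "thin F" "hat F \<subseteq> fin_subsets PNat" "hereditary (hat F)"
    "spreading_family (hat F)" "compact_family (hat F)" "F \<subseteq> hat F" "{} \<in> hat F"
proof -
  show F: "F \<subseteq> fin_subsets PNat" and "thin F" "hat F \<subseteq> fin_subsets PNat"
    and her: "hereditary (hat F)" and "spreading_family (hat F)" "compact_family (hat F)"
    using assms by (simp_all add: regular_thin_def regular_family_def)
  have "initial_segment s s" for s by (simp add: initial_segment_def)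
  then show "F \<subseteq> hat F" using F unfolding hat_def by blast
  obtain s where "s \<in> hat F"
    using assms unfolding regular_thin_def regular_family_def by blast
  then show "{} \<in> hat F" using her unfolding hereditary_def by blast
qed

text \<open>The empty set is an initial segment of everything, so a thin family that contains it contains
  nothing else.\<close>

lemma empty_notin_thin:
  assumes "thin F" "F \<noteq> {{}}" shows "{} \<notin> F"
proof
  assume e: "{} \<in> F"
  have "{} = s" if "s \<in> F" for s
  proof -
    have "initial_segment {} s" by (simp add: initial_segment_def)
    then show ?thesis using assms(1) e that unfolding thin_def by blast
  qed
  then show False using assms(2) e by blast
qed

text \<open>A node outside \<open>F\<close> is a proper initial segment of some \<open>s \<in> F\<close>, so adding an element \<open>m0\<close> of \<open>s\<close>
  keeps it in \<open>hat F\<close>; as \<open>hat F\<close> is spreading, \<open>m0\<close> may be replaced by any larger \<open>m \<in> L\<close>. Small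
  \<open>m\<close> may fail, which is why all later choices are made far out in \<open>L\<close>.\<close>

lemma eventually_child:
  assumes F: "regular_thin F" and L: "L \<subseteq> PNat" and t: "t \<in> restr (hat F) L" "t \<notin> F"
  obtains m0 where "\<And>y. y \<in> t \<Longrightarrow> y < m0"
    and "\<And>m. m \<in> L \<Longrightarrow> m0 \<le> m \<Longrightarrow> insert m t \<in> restr (hat F) L"
proof -
  note P = regular_thinD[OF F]
  have tfin: "finite t" "t \<subseteq> L" "t \<in> hat F" using t by (auto simp: restr_def fin_subsets_def)
  obtain s where s: "s \<in> F" "initial_segment t s" using tfin by (auto simp: hat_def)
  have "finite s" using s P by (auto simp: fin_subsets_def)
  have "t \<subset> s" using s t by (auto simp: initial_segment_def)
  then obtain m0 where m0: "m0 \<in> s" "m0 \<notin> t" by blast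
  have less: "y < m0" if "y \<in> t" for y
  proof (rule ccontr)
    assume "\<not> y < m0"
    then have "m0 \<le> y" by simp
    then show False using s(2) m0 that unfolding initial_segment_def by blast
  qed
  have base: "insert m0 t \<in> hat F"
  proof -
    have "s \<in> hat F" "insert m0 t \<subseteq> s" using P(7) s(1) m0 \<open>t \<subset> s\<close> by auto
    then show ?thesis using P(4) unfolding hereditary_def by blast
  qed
  have "insert m t \<in> restr (hat F) L" if m: "m \<in> L" "m0 \<le> m" for m
  proof -
    have lessm: "y < m" if "y \<in> t" for y using less[OF that] m by simp
    have sub: "insert m t \<in> fin_subsets L" using tfin m by (auto simp: fin_subsets_def)
    have nin: "m0 \<notin> t" "m \<notin> t" using less lessm by auto
    have "elt (insert m0 t) i \<le> elt (insert m t) i" if "i \<in> {1..card (insert m0 t)}" for i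
    proof -
      have "i = Suc (i - 1)" "i - 1 \<le> card t" using that nin tfin by auto
      then obtain i' where i': "i = Suc i'" "i' \<le> card t" using that by metis
      show ?thesis
      proof (cases "i' < card t")
        case True
        then show ?thesis
          using elt_insert_max(1)[OF tfin(1), of m0] elt_insert_max(1)[OF tfin(1), of m] less lessm i' by simp
      next
        case False
        then have "i' = card t" using i' by simp
        then show ?thesis
          using elt_insert_max(2)[OF tfin(1), of m0] elt_insert_max(2)[OF tfin(1), of m] less lessm i' m by simp
      qed
    qed
    moreover have "card (insert m t) = card (insert m0 t)" using nin tfin by simp
    moreover have "insert m t \<in> fin_subsets PNat" using sub L by (auto simp: fin_subsets_def)
    ultimately have "insert m t \<in> hat F"
      using P(5)[unfolded spreading_family_def, rule_format, OF base] by blast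
    then show ?thesis using sub by (simp add: restr_def)
  qed
  with less show ?thesis using that by blast
qed

lemma wf_restricted_hat:
  assumes "regular_thin F"
  shows "wf {(s, t). s \<in> restr (hat F) L \<and> t \<in> restr (hat F) L \<and> t \<subset> s}"
  by (rule wf_subset[OF wf_compact_family[of "hat F"]])
    (use regular_thinD[OF assms] in \<open>auto simp: restr_def\<close>)

text \<open>Far elements of \<open>L\<close> are added one by one; well-foundedness makes the process stop, necessarily
  at a member of \<open>F\<close>. From the root this gives members of \<open>F\<close> inside \<open>L\<close> that start arbitrarily late.\<close>

lemma extend_to_member:
  assumes F: "regular_thin F" and L: "L \<in> inf_subsets PNat" and "t \<in> restr (hat F) L"
  shows "\<exists>s\<in>restr F L. t \<subseteq> s \<and> (\<forall>y\<in>s - t. n < y)"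
  using assms(3)
proof (induction t rule: wf_induct_rule[OF wf_restricted_hat[OF F, of L]])
  case (1 t)
  show ?case
  proof (cases "t \<in> F")
    case True
    then show ?thesis using 1(2) by (auto simp: restr_def)
  next
    case False
    have L': "L \<subseteq> PNat" "infinite L" using L by (auto simp: inf_subsets_def)
    obtain m0 where m0: "\<And>y. y \<in> t \<Longrightarrow> y < m0"
      "\<And>m. m \<in> L \<Longrightarrow> m0 \<le> m \<Longrightarrow> insert m t \<in> restr (hat F) L"
      using eventually_child[OF F L'(1) 1(2) False] by blast
    obtain m where m: "m \<in> L" "max m0 n < m" using L'(2) unfolding infinite_nat_iff_unbounded by blast
    have node: "insert m t \<in> restr (hat F) L" by (rule m0(2)) (use m in simp_all)
    moreover have "t \<subset> insert m t" using m0(1)[of m] m(2) by auto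
    ultimately have "(insert m t, t) \<in> {(s, t). s \<in> restr (hat F) L \<and> t \<in> restr (hat F) L \<and> t \<subset> s}"
      using 1(2) by simp
    from 1(1)[OF this node]
    obtain s where "s \<in> restr F L" "insert m t \<subseteq> s" "\<forall>y\<in>s - insert m t. n < y" by blast
    then show ?thesis using m by (intro bexI[of _ s]) auto
  qed
qed

text \<open>Neighbourhoods in the Cantor space are given by finitely many coordinates, so weak continuity reads
  as a condition on sets that agree up to some \<open>n\<close>.\<close>

lemma weakly_continuous_at_node:
  fixes \<phi> :: "nat set \<Rightarrow> 'a::real_normed_vector" and f :: "'a \<Rightarrow> real"
  assumes cont: "continuous_map (pullback_topology G char_fun cantor_space) weak_topology \<phi>"
    and t: "t \<in> G" and f: "bounded_linear f" and "\<epsilon> > 0"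
  obtains n where "\<And>s. s \<in> G \<Longrightarrow> s \<inter> {..n} = t \<inter> {..n} \<Longrightarrow> \<bar>f (\<phi> s) - f (\<phi> t)\<bar> < \<epsilon>"
proof -
  let ?X = "pullback_topology G char_fun cantor_space"
  define V where "V = f -` ball (f (\<phi> t)) \<epsilon>"
  have "openin weak_topology V" unfolding weak_topology_def V_def
    by (rule topology_generated_by_Basis) (use f in auto)
  then have "openin ?X {s \<in> topspace ?X. \<phi> s \<in> V}"
    by (rule openin_continuous_map_preimage[OF cont])
  then obtain U where U: "openin cantor_space U" "{s \<in> topspace ?X. \<phi> s \<in> V} = char_fun -` U \<inter> G"
    unfolding openin_pullback_topology by blast
  have top: "topspace ?X = G"
    using char_fun_in_cantor_space by (auto simp: topspace_pullback_topology)
  have "t \<in> char_fun -` U \<inter> G"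
    unfolding U(2)[symmetric] top using t \<open>\<epsilon> > 0\<close> by (simp add: V_def)
  then have "char_fun t \<in> U" by simp
  then obtain X where X: "char_fun t \<in> (\<Pi>\<^sub>E i\<in>PNat. X i)"
      "finite {i. X i \<noteq> topspace (discrete_topology {0, 1})}" "(\<Pi>\<^sub>E i\<in>PNat. X i) \<subseteq> U"
    using product_topology_open_contains_basis[OF U(1)[unfolded cantor_space_def]] by metis
  obtain n where n: "\<And>i. X i \<noteq> {0, 1} \<Longrightarrow> i \<le> n"
    using X(2) unfolding finite_nat_set_iff_bounded_le by auto
  show ?thesis
  proof (rule that)
    fix s assume s: "s \<in> G" "s \<inter> {..n} = t \<inter> {..n}"
    have "char_fun s i \<in> X i" if i: "i \<in> PNat" for i
    proof (cases "X i = {0, 1}")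
      case True then show ?thesis using i by (auto simp: char_fun_def indicator_def)
    next
      case False
      then have "i \<in> s \<longleftrightarrow> i \<in> t" using n s(2) by blast
      then have "char_fun s i = char_fun t i" by (simp add: char_fun_def restrict_def indicator_def)
      then show ?thesis using X(1) i by auto
    qed
    then have "char_fun s \<in> (\<Pi>\<^sub>E i\<in>PNat. X i)" by (auto simp: char_fun_def)
    then have "s \<in> char_fun -` U \<inter> G" using X(3) s(1) by blast
    then have "\<phi> s \<in> V" unfolding U(2)[symmetric] by blast
    then show "\<bar>f (\<phi> s) - f (\<phi> t)\<bar> < \<epsilon>" by (simp add: V_def dist_real_def abs_minus_commute)
  qed
qed

text \<open>Members of \<open>F\<close> with large minimum converge to the empty set in the Cantor space, so their images
  tend weakly to \<open>\<phi> {}\<close> by continuity and to \<open>0\<close> by weak nullness.\<close>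

lemma root_image_zero:
  fixes x \<phi> :: "nat set \<Rightarrow> 'a::real_normed_vector"
  assumes F: "regular_thin F" "F \<noteq> {{}}" and L: "L \<in> inf_subsets PNat"
    and null: "weakly_null F L x"
    and cont: "continuous_map (pullback_topology (restr (hat F) L) char_fun cantor_space) weak_topology \<phi>"
    and \<phi>: "\<And>s. s \<in> restr F L \<Longrightarrow> \<phi> s = x s"
  shows "\<phi> {} = 0"
proof -
  note P = regular_thinD[OF F(1)]
  have root: "{} \<in> restr (hat F) L" using P(8) by (simp add: restr_def fin_subsets_def)
  have "\<bar>f (\<phi> {})\<bar> < \<epsilon>" if f: "bounded_linear f" and \<epsilon>: "\<epsilon> > 0" for f :: "'a \<Rightarrow> real" and \<epsilon>
  proof -
    have "\<epsilon> / 2 > 0" using \<epsilon> by simp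
    obtain n where n: "\<And>s. s \<in> restr (hat F) L \<Longrightarrow> s \<inter> {..n} = {} \<inter> {..n} \<Longrightarrow> \<bar>f (\<phi> s) - f (\<phi> {})\<bar> < \<epsilon> / 2"
      using weakly_continuous_at_node[OF cont root f \<open>\<epsilon> / 2 > 0\<close>] by metis
    have "openin weak_topology (f -` ball 0 (\<epsilon> / 2))" unfolding weak_topology_def
      by (rule topology_generated_by_Basis) (use f in auto)
    moreover have "0 \<in> f -` ball 0 (\<epsilon> / 2)"
      using \<epsilon> linear_0[OF bounded_linear.linear[OF f]] by simp
    ultimately have "\<exists>m\<ge>1. \<forall>s\<in>restr F L. elt L m \<le> Min s \<longrightarrow> x s \<in> f -` ball 0 (\<epsilon> / 2)"
      using null[unfolded weakly_null_def, rule_format, of "f -` ball 0 (\<epsilon> / 2)"] by simp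
    then obtain m where m: "\<And>s. s \<in> restr F L \<Longrightarrow> elt L m \<le> Min s \<Longrightarrow> x s \<in> f -` ball 0 (\<epsilon> / 2)"
      by metis
    obtain s where s: "s \<in> restr F L" "\<forall>y\<in>s - {}. max n (elt L m) < y"
      using extend_to_member[OF F(1) L root] by blast
    have "s \<noteq> {}" using s(1) empty_notin_thin[OF P(2) F(2)] by (auto simp: restr_def)
    moreover have "finite s" using s(1) by (auto simp: restr_def fin_subsets_def)
    ultimately have "elt L m \<le> Min s" using s(2) by (auto intro: less_imp_le)
    then have "\<bar>f (x s)\<bar> < \<epsilon> / 2" using m[OF s(1)] by (simp add: dist_real_def)
    moreover have "\<bar>f (\<phi> s) - f (\<phi> {})\<bar> < \<epsilon> / 2"
      using s P(7) by (intro n) (auto simp: restr_def)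
    ultimately show ?thesis using \<phi>[OF s(1)] by (simp del: divide_const_simps)
  qed
  \<comment> \<open>That functionals separate points is the case \<open>S = {0}\<close> of Mazur's theorem.\<close>
  then have weak: "\<exists>s\<in>{0}. \<bar>f s - f (\<phi> {})\<bar> < \<epsilon>" if "bounded_linear f" "\<epsilon> > 0" for f :: "'a \<Rightarrow> real" and \<epsilon>
    using that linear_0[OF bounded_linear.linear[OF that(1)]] by simp
  have "norm (\<phi> {}) < \<epsilon>" if pos: "\<epsilon> > 0" for \<epsilon>
  proof -
    obtain S0 y where y: "S0 \<subseteq> {0}" "y \<in> convex hull S0" "dist y (\<phi> {}) < \<epsilon>"
      using weak_limit_in_closure_convex_hull[of "{0}" "\<phi> {}", OF weak pos] by metis
    then have "y \<in> convex hull {0}" using hull_mono by blast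
    then show ?thesis using y by (simp add: dist_norm)
  qed
  then show ?thesis by (metis less_irrefl zero_less_norm_iff)
qed

lemma children_approximate_node:
  fixes \<phi> :: "nat set \<Rightarrow> 'a::real_normed_vector"
  assumes F: "regular_thin F" and L: "L \<in> inf_subsets PNat"
    and cont: "continuous_map (pullback_topology (restr (hat F) L) char_fun cantor_space) weak_topology \<phi>"
    and t: "t \<in> restr (hat F) L" "t \<notin> F" and "\<epsilon> > 0"
  obtains T y where "finite T" "\<And>m. m \<in> T \<Longrightarrow> n < m \<and> insert m t \<in> restr (hat F) L"
    "y \<in> convex hull ((\<lambda>m. \<phi> (insert m t)) ` T)" "dist y (\<phi> t) < \<epsilon>"
proof -
  have L': "L \<subseteq> PNat" "infinite L" using L by (auto simp: inf_subsets_def)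
  obtain m0 where m0: "\<And>y. y \<in> t \<Longrightarrow> y < m0"
    "\<And>m. m \<in> L \<Longrightarrow> m0 \<le> m \<Longrightarrow> insert m t \<in> restr (hat F) L"
    using eventually_child[OF F L'(1) t] by blast
  define M where "M = {m. n < m \<and> insert m t \<in> restr (hat F) L}"
  define S where "S = (\<lambda>m. \<phi> (insert m t)) ` M"
  have weak: "\<exists>s\<in>S. \<bar>f s - f (\<phi> t)\<bar> < \<delta>" if f: "bounded_linear f" "\<delta> > 0" for f :: "'a \<Rightarrow> real" and \<delta>
  proof -
    obtain n' where n': "\<And>s. s \<in> restr (hat F) L \<Longrightarrow> s \<inter> {..n'} = t \<inter> {..n'} \<Longrightarrow> \<bar>f (\<phi> s) - f (\<phi> t)\<bar> < \<delta>"
      using weakly_continuous_at_node[OF cont t(1) f] by metis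
    obtain m where m: "m \<in> L" "max m0 (max n n') < m" using L'(2) unfolding infinite_nat_iff_unbounded by blast
    then have "insert m t \<in> restr (hat F) L" by (intro m0(2)) simp_all
    moreover have "insert m t \<inter> {..n'} = t \<inter> {..n'}" using m by auto
    ultimately have "\<bar>f (\<phi> (insert m t)) - f (\<phi> t)\<bar> < \<delta>" "m \<in> M"
      using n' m by (simp_all add: M_def)
    then show ?thesis unfolding S_def by blast
  qed
  obtain S0 y where S0: "finite S0" "S0 \<subseteq> S" "y \<in> convex hull S0" "dist y (\<phi> t) < \<epsilon>"
    using weak_limit_in_closure_convex_hull[of S "\<phi> t", OF weak \<open>\<epsilon> > 0\<close>] by metis
  obtain T where T: "T \<subseteq> M" "finite T" "S0 = (\<lambda>m. \<phi> (insert m t)) ` T"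
    using finite_subset_image[OF S0(1) S0(2)[unfolded S_def]] by blast
  show ?thesis by (rule that[of T y]) (use T S0(3,4) in \<open>auto simp: M_def\<close>)
qed

section \<open>Finite sets of members interleaved along a sequence of blocks\<close>

text \<open>Block \<open>q\<close> is the interval from \<open>N q\<close> (excluded) to \<open>N (Suc q)\<close> (included). In round \<open>i\<close> the index \<open>j\<close>,
  with \<open>1 \<le> j \<le> k\<close>, owns the block \<open>i * k + j\<close>; the rounds count from \<open>0\<close>, whereas \<^const>\<open>elt\<close>
  counts from \<open>1\<close>.\<close>

definition in_blocks :: "(nat \<Rightarrow> nat) \<Rightarrow> nat \<Rightarrow> nat \<Rightarrow> nat set \<Rightarrow> bool" where
  "in_blocks N k j t \<longleftrightarrow>
    (\<forall>i<card t. N (i * k + j) < elt t (Suc i) \<and> elt t (Suc i) \<le> N (Suc (i * k + j)))"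

lemma in_blocks_bound:
  assumes "mono N" "k \<ge> 1" "in_blocks N k j t" "finite t"
  shows "t \<subseteq> {..N (card t * k + j)}"
proof
  fix y assume "y \<in> t"
  then obtain i where i: "i < card t" "elt t (Suc i) = y" using elt_surj assms(4) by blast
  have "Suc i * k \<le> card t * k" using i by (intro mult_le_mono1) simp
  then have "Suc (i * k + j) \<le> card t * k + j" using assms(2) by simp
  then have "N (Suc (i * k + j)) \<le> N (card t * k + j)" by (rule monoD[OF assms(1)])
  then show "y \<in> {..N (card t * k + j)}" using assms(3) i unfolding in_blocks_def by force
qed

lemma in_blocks_insert:
  assumes "in_blocks N k j t" "finite t" and m: "\<And>y. y \<in> t \<Longrightarrow> y < m"
    and "N (card t * k + j) < m" "m \<le> N (Suc (card t * k + j))"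
  shows "in_blocks N k j (insert m t)"
  unfolding in_blocks_def
proof (intro allI impI)
  fix i assume i: "i < card (insert m t)"
  have "m \<notin> t" using m by blast
  then consider "i < card t" | "i = card t" using i assms(2) by fastforce
  then show "N (i * k + j) < elt (insert m t) (Suc i) \<and> elt (insert m t) (Suc i) \<le> N (Suc (i * k + j))"
  proof cases
    case 1
    then show ?thesis using assms(1) elt_insert_max(1)[OF assms(2) m 1] by (simp add: in_blocks_def)
  next
    case 2
    then show ?thesis using assms(4,5) elt_insert_max(2)[OF assms(2) m] by simp
  qed
qed

text \<open>The blocks owned by \<open>1, \<dots>, k\<close> in one round precede each other in this order and all of them precede
  the blocks of the next round; these are the two plegma conditions.\<close>

lemma plegma_if_in_blocks:
  assumes N: "mono N"
    and s: "\<And>j. j \<in> {1..k} \<Longrightarrow> s j \<in> fin_subsets PNat \<and> s j \<noteq> {} \<and> in_blocks N k j (s j)"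
  shows "plegma k s"
  unfolding plegma_def
proof (intro conjI ballI impI)
  fix j assume "j \<in> {1..k}"
  then show "s j \<in> fin_subsets PNat" "s j \<noteq> {}" using s by auto
next
  fix i j m assume ij: "i \<in> {1..k}" "j \<in> {1..k}" "i < j"
    and m: "m \<in> {1..min (card (s i)) (card (s j))}"
  obtain m' where m': "m = Suc m'" using m by (cases m) auto
  have "elt (s i) m \<le> N (Suc (m' * k + i))" using s[OF ij(1)] m m' by (simp add: in_blocks_def)
  also have "\<dots> \<le> N (m' * k + j)" using ij by (intro monoD[OF N]) simp
  also have "\<dots> < elt (s j) m" using s[OF ij(2)] m m' by (simp add: in_blocks_def)
  finally show "elt (s i) m < elt (s j) m" .
next
  fix i j m assume ij: "i \<in> {1..k}" "j \<in> {1..k}"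
    and m: "m \<in> {1..min (card (s i)) (card (s j) - 1)}"
  obtain m' where m': "m = Suc m'" using m by (cases m) auto
  have "elt (s i) m \<le> N (Suc (m' * k + i))" using s[OF ij(1)] m m' by (simp add: in_blocks_def)
  also have "\<dots> \<le> N (Suc m' * k + j)" using ij by (intro monoD[OF N]) simp
  also have "\<dots> < elt (s j) (m + 1)"
  proof -
    have "Suc m' < card (s j)" using m m' by (simp add: le_diff_conv) linarith
    then have "N (Suc m' * k + j) < elt (s j) (Suc (Suc m'))"
      using s[OF ij(2)] unfolding in_blocks_def by blast
    then show ?thesis by (simp add: m')
  qed
  finally show "elt (s i) m < elt (s j) (m + 1)" .
qed

lemma plegma_subfamily:
  assumes s: "plegma k s" and \<kappa>: "\<kappa> ` {1..n} \<subseteq> {1..k}" "strict_mono_on {1..n} \<kappa>"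
  shows "plegma n (\<lambda>j\<in>{1..n}. s (\<kappa> j))"
proof -
  have "\<kappa> j \<in> {1..k}" if "j \<in> {1..n}" for j using \<kappa>(1) that by blast
  moreover have "\<kappa> i < \<kappa> j" if "i \<in> {1..n}" "j \<in> {1..n}" "i < j" for i j
    using strict_mono_onD[OF \<kappa>(2) that] .
  ultimately show ?thesis using s unfolding plegma_def by simp
qed

text \<open>Only finitely many nodes \<open>t\<close> lie below \<open>N q\<close>, and for each of them finitely many children beyond
  \<open>N q\<close> suffice to approximate \<open>\<phi> t\<close>; \<open>N (Suc q)\<close> is chosen beyond all of these. Thus one sequence
  of blocks serves all nodes, and the positions of a plegma family can be treated
  independently of each other.\<close>

lemma exists_block_sequence:
  fixes \<phi> :: "nat set \<Rightarrow> 'a::real_normed_vector"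
  assumes F: "regular_thin F" and L: "L \<in> inf_subsets PNat"
    and cont: "continuous_map (pullback_topology (restr (hat F) L) char_fun cantor_space) weak_topology \<phi>"
    and "\<epsilon> > 0"
  obtains N :: "nat \<Rightarrow> nat" where "N 0 = n0" "mono N"
    "\<And>q t. t \<in> restr (hat F) L \<Longrightarrow> t \<notin> F \<Longrightarrow> t \<subseteq> {..N q} \<Longrightarrow>
       \<exists>T y. finite T \<and> (\<forall>m\<in>T. N q < m \<and> m \<le> N (Suc q) \<and> insert m t \<in> restr (hat F) L) \<and>
         y \<in> convex hull ((\<lambda>m. \<phi> (insert m t)) ` T) \<and> dist y (\<phi> t) < \<epsilon> / 2 ^ Suc q"
proof -
  define G where "G = restr (hat F) L"
  define P where "P = (\<lambda>q n n' t T y. finite T \<and> (\<forall>m\<in>T. n < m \<and> m \<le> n' \<and> insert m t \<in> G) \<and>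
         y \<in> convex hull ((\<lambda>m. \<phi> (insert m t)) ` T) \<and> dist y (\<phi> t) < \<epsilon> / 2 ^ Suc q)"
  have "\<exists>n'\<ge>n. \<forall>t\<in>G. t \<notin> F \<longrightarrow> t \<subseteq> {..n} \<longrightarrow> (\<exists>T y. P q n n' t T y)" for q n
  proof -
    define A where "A = {t \<in> G. t \<notin> F \<and> t \<subseteq> {..n}}"
    have "finite A" by (rule finite_subset[of _ "Pow {..n}"]) (auto simp: A_def)
    have "\<forall>t\<in>A. \<exists>T. finite T \<and> (\<forall>m\<in>T. n < m \<and> insert m t \<in> G) \<and>
      (\<exists>y\<in>convex hull ((\<lambda>m. \<phi> (insert m t)) ` T). dist y (\<phi> t) < \<epsilon> / 2 ^ Suc q)"
    proof
      fix t assume t: "t \<in> A"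
      then have t': "t \<in> restr (hat F) L" "t \<notin> F" by (auto simp: A_def G_def)
      have "\<epsilon> / 2 ^ Suc q > 0" using \<open>\<epsilon> > 0\<close> by simp
      from children_approximate_node[OF F L cont t' this, of n]
      show "\<exists>T. finite T \<and> (\<forall>m\<in>T. n < m \<and> insert m t \<in> G) \<and>
        (\<exists>y\<in>convex hull ((\<lambda>m. \<phi> (insert m t)) ` T). dist y (\<phi> t) < \<epsilon> / 2 ^ Suc q)"
        unfolding G_def by metis
    qed
    from bchoice[OF this] obtain T where T: "\<And>t. t \<in> A \<Longrightarrow> finite (T t) \<and> (\<forall>m\<in>T t. n < m \<and> insert m t \<in> G) \<and>
      (\<exists>y\<in>convex hull ((\<lambda>m. \<phi> (insert m t)) ` T t). dist y (\<phi> t) < \<epsilon> / 2 ^ Suc q)" by blast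
    define n' where "n' = Max (insert n (\<Union>t\<in>A. T t))"
    have fin: "finite (insert n (\<Union>t\<in>A. T t))" using \<open>finite A\<close> T by blast
    have "n \<le> n'" unfolding n'_def by (rule Max_ge[OF fin]) simp
    moreover have "\<exists>T y. P q n n' t T y" if "t \<in> G" "t \<notin> F" "t \<subseteq> {..n}" for t
    proof -
      have t: "t \<in> A" using that by (simp add: A_def)
      have "m \<le> n'" if "m \<in> T t" for m unfolding n'_def by (rule Max_ge[OF fin]) (use that t in blast)
      moreover obtain y where "y \<in> convex hull ((\<lambda>m. \<phi> (insert m t)) ` T t)" "dist y (\<phi> t) < \<epsilon> / 2 ^ Suc q"
        using T[OF t] by blast
      ultimately have "P q n n' t (T t) y" using T[OF t] unfolding P_def by simp
      then show ?thesis by blast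
    qed
    ultimately show ?thesis by blast
  qed
  then have "\<forall>q. \<forall>n. \<exists>n'. n \<le> n' \<and> (\<forall>t\<in>G. t \<notin> F \<longrightarrow> t \<subseteq> {..n} \<longrightarrow> (\<exists>T y. P q n n' t T y))"
    by blast
  then obtain h where "\<forall>q n. n \<le> h q n \<and>
      (\<forall>t\<in>G. t \<notin> F \<longrightarrow> t \<subseteq> {..n} \<longrightarrow> (\<exists>T y. P q n (h q n) t T y))"
    unfolding choice_iff by blast
  then have h: "n \<le> h q n" "t \<in> G \<Longrightarrow> t \<notin> F \<Longrightarrow> t \<subseteq> {..n} \<Longrightarrow> \<exists>T y. P q n (h q n) t T y" for q n t
    by blast+
  define N where "N = rec_nat n0 h"
  have N: "N 0 = n0" "N (Suc q) = h q (N q)" for q by (simp_all add: N_def)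
  have "mono N" by (rule mono_iff_le_Suc[THEN iffD2]) (simp add: N h)
  moreover have "\<exists>T y. P q (N q) (N (Suc q)) t T y" if "t \<in> G" "t \<notin> F" "t \<subseteq> {..N q}" for q t
    using h(2)[OF that] by (simp add: N)
  ultimately show ?thesis using that[of N] N(1) unfolding P_def G_def by blast
qed

text \<open>Used to pass from approximating each point of a set to approximating its convex hull.\<close>

lemma convex_ball_neighbourhood:
  fixes C :: "'a::real_normed_vector set"
  assumes "convex C" shows "convex {v. \<exists>y\<in>C. dist y v < r}"
proof -
  have "{v. \<exists>y\<in>C. dist y v < r} = (\<Union>y\<in>C. \<Union>z\<in>ball 0 r. {y + z})" (is "?A = ?B")
  proof
    show "?A \<subseteq> ?B"
    proof
      fix v assume "v \<in> ?A"
      then obtain y where "y \<in> C" "dist y v < r" by blast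
      moreover have "dist 0 (v - y) = dist y v" unfolding dist_norm by (simp add: norm_minus_commute)
      ultimately have "v - y \<in> ball 0 r" "v = y + (v - y)" by simp_all
      then show "v \<in> ?B" using \<open>y \<in> C\<close> by blast
    qed
    show "?B \<subseteq> ?A"
    proof
      fix v assume "v \<in> ?B"
      then obtain y z where "y \<in> C" "norm z < r" "v = y + z" by auto
      then show "v \<in> ?A" by (auto simp: dist_norm intro!: bexI[of _ y])
    qed
  qed
  then show ?thesis using convex_sums[OF assms convex_ball] by simp
qed

text \<open>Well-founded induction from the members of \<open>F\<close> towards the root. A node of cardinality \<open>n\<close> is
  within \<open>\<epsilon> / 2 ^ Suc n\<close> of the hull of its children in the next owned block, and these
  are within \<open>\<epsilon> / 2 ^ Suc n\<close> of the hull of members by induction; the bound \<open>\<epsilon> / 2 ^ n\<close> is what makes the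
  two errors add up.\<close>

lemma node_near_hull_of_members:
  fixes \<phi> :: "nat set \<Rightarrow> 'a::real_normed_vector"
  assumes F: "regular_thin F" and N: "mono N" and k: "k \<ge> 1" and "\<epsilon> > 0"
    and step: "\<And>q t. t \<in> restr (hat F) L \<Longrightarrow> t \<notin> F \<Longrightarrow> t \<subseteq> {..N q} \<Longrightarrow>
       \<exists>T y. finite T \<and> (\<forall>m\<in>T. N q < m \<and> m \<le> N (Suc q) \<and> insert m t \<in> restr (hat F) L) \<and>
         y \<in> convex hull ((\<lambda>m. \<phi> (insert m t)) ` T) \<and> dist y (\<phi> t) < \<epsilon> / 2 ^ Suc q"
    and "t \<in> restr (hat F) L" "in_blocks N k j t"
  shows "\<exists>T. finite T \<and> T \<subseteq> restr F L \<and> (\<forall>s\<in>T. in_blocks N k j s) \<and>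
    (\<exists>y\<in>convex hull (\<phi> ` T). dist y (\<phi> t) < \<epsilon> / 2 ^ card t)"
  using assms(6,7)
proof (induction t rule: wf_induct_rule[OF wf_restricted_hat[OF F, of L]])
  case (1 t)
  note tG = 1(2) and tN = 1(3)
  have tfin: "finite t" "t \<subseteq> L" using tG by (auto simp: restr_def fin_subsets_def)
  show ?case
  proof (cases "t \<in> F")
    case True
    then have "t \<in> restr F L" using tG by (simp add: restr_def)
    then show ?thesis using tN \<open>\<epsilon> > 0\<close> by (intro exI[of _ "{t}"]) simp
  next
    case False
    let ?q = "card t * k + j" and ?n = "card t"
    obtain M y where M: "finite M" "\<And>m. m \<in> M \<Longrightarrow> N ?q < m \<and> m \<le> N (Suc ?q) \<and> insert m t \<in> restr (hat F) L"
      and y: "y \<in> convex hull ((\<lambda>m. \<phi> (insert m t)) ` M)" "dist y (\<phi> t) < \<epsilon> / 2 ^ Suc ?q"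
      using step[OF tG False in_blocks_bound[OF N k tN tfin(1)]] by metis
    have "\<forall>m\<in>M. \<exists>T. finite T \<and> T \<subseteq> restr F L \<and> (\<forall>s\<in>T. in_blocks N k j s) \<and>
      (\<exists>z\<in>convex hull (\<phi> ` T). dist z (\<phi> (insert m t)) < \<epsilon> / 2 ^ Suc ?n)"
    proof
      fix m assume m: "m \<in> M"
      have less: "y < m" if "y \<in> t" for y
        using in_blocks_bound[OF N k tN tfin(1)] that M(2)[OF m] by force
      then have "m \<notin> t" by blast
      then have card: "card (insert m t) = Suc ?n" using tfin by simp
      have node: "insert m t \<in> restr (hat F) L" using M(2)[OF m] by simp
      have "(insert m t, t) \<in> {(s, t). s \<in> restr (hat F) L \<and> t \<in> restr (hat F) L \<and> t \<subset> s}"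
        using tG node \<open>m \<notin> t\<close> by auto
      from 1(1)[OF this node in_blocks_insert[OF tN tfin(1) less]] M(2)[OF m]
      show "\<exists>T. finite T \<and> T \<subseteq> restr F L \<and> (\<forall>s\<in>T. in_blocks N k j s) \<and>
        (\<exists>z\<in>convex hull (\<phi> ` T). dist z (\<phi> (insert m t)) < \<epsilon> / 2 ^ Suc ?n)"
        unfolding card by simp
    qed
    from bchoice[OF this] obtain T where T: "\<And>m. m \<in> M \<Longrightarrow> finite (T m) \<and> T m \<subseteq> restr F L \<and> (\<forall>s\<in>T m. in_blocks N k j s) \<and>
      (\<exists>z\<in>convex hull (\<phi> ` T m). dist z (\<phi> (insert m t)) < \<epsilon> / 2 ^ Suc ?n)" by blast
    define U where "U = (\<Union>m\<in>M. T m)"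
    define V where "V = {v. \<exists>z\<in>convex hull (\<phi> ` U). dist z v < \<epsilon> / 2 ^ Suc ?n}"
    have "\<phi> (insert m t) \<in> V" if m: "m \<in> M" for m
    proof -
      obtain z where "z \<in> convex hull (\<phi> ` T m)" "dist z (\<phi> (insert m t)) < \<epsilon> / 2 ^ Suc ?n"
        using T[OF m] by blast
      moreover have "convex hull (\<phi> ` T m) \<subseteq> convex hull (\<phi> ` U)"
        by (rule hull_mono) (use m in \<open>auto simp: U_def\<close>)
      ultimately show ?thesis unfolding V_def by blast
    qed
    moreover have "convex V" unfolding V_def by (rule convex_ball_neighbourhood) (rule convex_convex_hull)
    ultimately have "convex hull ((\<lambda>m. \<phi> (insert m t)) ` M) \<subseteq> V" by (intro hull_minimal) auto
    with y(1) obtain z where z: "z \<in> convex hull (\<phi> ` U)" "dist z y < \<epsilon> / 2 ^ Suc ?n"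
      unfolding V_def by blast
    \<comment> \<open>The step in block \<open>?q\<close> is at least as accurate as the level \<open>?n\<close> of the tree requires.\<close>
    have "?n \<le> ?q" using k by (simp add: trans_le_add1)
    then have "\<epsilon> / 2 ^ Suc ?q \<le> \<epsilon> / 2 ^ Suc ?n"
      using \<open>\<epsilon> > 0\<close> by (intro divide_left_mono power_increasing mult_pos_pos) auto
    moreover have "dist z (\<phi> t) \<le> dist z y + dist y (\<phi> t)" by (rule dist_triangle)
    ultimately have "dist z (\<phi> t) < \<epsilon> / 2 ^ Suc ?n + \<epsilon> / 2 ^ Suc ?n" using y(2) z(2) by linarith
    also have "\<dots> = \<epsilon> / 2 ^ ?n" by simp
    finally have "dist z (\<phi> t) < \<epsilon> / 2 ^ ?n" .
    moreover have "finite U" using M(1) T by (auto simp: U_def)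
    moreover have "U \<subseteq> restr F L" "\<forall>s\<in>U. in_blocks N k j s" using T by (auto simp: U_def)
    ultimately show ?thesis using z(1) by (intro exI[of _ U]) blast
  qed
qed

section \<open>The spreading model\<close>

text \<open>Lemma \<open>node_near_hull_of_members\<close> at the root \<open>{}\<close>, where \<open>\<phi>\<close> vanishes, once for each position \<open>j\<close>.\<close>

lemma exists_interleaved_sets:
  fixes x :: "nat set \<Rightarrow> 'a::real_normed_vector"
  assumes F: "regular_thin F" "F \<noteq> {{}}" and L: "L \<in> inf_subsets PNat"
    and sub: "subordinated F L x" and null: "weakly_null F L x"
    and k: "k \<ge> 1" and "\<epsilon> > 0"
  obtains T where "\<And>j. j \<in> {1..k} \<Longrightarrow> T j \<subseteq> restr F L"
    "\<And>j. j \<in> {1..k} \<Longrightarrow> \<exists>y\<in>convex hull (x ` T j). norm y < \<epsilon>"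
    "\<And>s. s \<in> Pi {1..k} T \<Longrightarrow> plegma k s"
    "\<And>j s y. j \<in> {1..k} \<Longrightarrow> s \<in> T j \<Longrightarrow> y \<in> s \<Longrightarrow> n0 < y"
proof -
  note P = regular_thinD[OF F(1)]
  obtain \<phi> where cont: "continuous_map (pullback_topology (restr (hat F) L) char_fun cantor_space) weak_topology \<phi>"
    and \<phi>: "\<And>s. s \<in> restr F L \<Longrightarrow> \<phi> s = x s"
    using sub unfolding subordinated_def by blast
  have \<phi>0: "\<phi> {} = 0" by (rule root_image_zero[OF F L null cont \<phi>])
  obtain N where N: "N 0 = n0" "mono N" and step:
    "\<And>q t. t \<in> restr (hat F) L \<Longrightarrow> t \<notin> F \<Longrightarrow> t \<subseteq> {..N q} \<Longrightarrow>
       \<exists>T y. finite T \<and> (\<forall>m\<in>T. N q < m \<and> m \<le> N (Suc q) \<and> insert m t \<in> restr (hat F) L) \<and>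
         y \<in> convex hull ((\<lambda>m. \<phi> (insert m t)) ` T) \<and> dist y (\<phi> t) < \<epsilon> / 2 ^ Suc q"
    by (rule exists_block_sequence[OF F(1) L cont \<open>\<epsilon> > 0\<close>, of n0]) (rule that)
  have root: "{} \<in> restr (hat F) L" using P(8) by (simp add: restr_def fin_subsets_def)
  have "\<exists>T. T \<subseteq> restr F L \<and> (\<forall>s\<in>T. in_blocks N k j s) \<and> (\<exists>y\<in>convex hull (x ` T). norm y < \<epsilon>)" for j
  proof -
    have "in_blocks N k j {}" by (simp add: in_blocks_def)
    from node_near_hull_of_members[OF F(1) N(2) k \<open>\<epsilon> > 0\<close> step root this]
    obtain T y where T: "T \<subseteq> restr F L" "\<forall>s\<in>T. in_blocks N k j s"
      and y: "y \<in> convex hull (\<phi> ` T)" "dist y (\<phi> {}) < \<epsilon> / 2 ^ card ({} :: nat set)" by blast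
    have "\<phi> ` T = x ` T" using T(1) \<phi> by (intro image_cong) auto
    moreover have "norm y < \<epsilon>" using y(2) by (simp add: \<phi>0)
    ultimately show ?thesis using T y(1) by auto
  qed
  then obtain T where T: "\<And>j. T j \<subseteq> restr F L" "\<And>j s. s \<in> T j \<Longrightarrow> in_blocks N k j s"
    "\<And>j. \<exists>y\<in>convex hull (x ` T j). norm y < \<epsilon>" by metis
  have mem: "s \<in> fin_subsets PNat \<and> s \<noteq> {}" if "s \<in> T j" for s j
    using that T(1)[of j] P(1) empty_notin_thin[OF P(2) F(2)] by (auto simp: restr_def)
  show ?thesis
  proof (rule that)
    show "T j \<subseteq> restr F L" "\<exists>y\<in>convex hull (x ` T j). norm y < \<epsilon>" for j using T by auto
    show "plegma k s" if "s \<in> Pi {1..k} T" for s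
      by (rule plegma_if_in_blocks[OF N(2)]) (use that mem T(2) in \<open>blast dest: Pi_mem\<close>)
    show "n0 < y" if y: "s \<in> T j" "y \<in> s" for j s y
    proof -
      have "finite s" using mem[OF y(1)] by (simp add: fin_subsets_def)
      then obtain i where "i < card s" "elt s (Suc i) = y" using elt_surj y(2) by blast
      then have "N (i * k + j) < y" using T(2)[OF y(1)] by (auto simp: in_blocks_def)
      moreover have "N 0 \<le> N (i * k + j)" by (rule monoD[OF N(2)]) simp
      ultimately show ?thesis using N(1) by simp
    qed
  qed
qed

text \<open>Starting the blocks beyond \<open>L(l)\<close> for a large \<open>l\<close> makes the defining estimate of the spreading
  model available, with the same small error, for all choices from the sets \<open>T j\<close> and for all their
  subfamilies \<open>\<kappa>\<close>.\<close>

lemma interleaved_sets_approximate_model: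
  fixes x :: "nat set \<Rightarrow> 'a::real_normed_vector"
    and p :: "'e::real_vector \<Rightarrow> real" and e :: "nat \<Rightarrow> 'e" and k :: nat
  assumes F: "regular_thin F" "F \<noteq> {{}}" and L: "L \<in> inf_subsets PNat"
    and gen: "generates_spreading_model F L x p e"
    and sub: "subordinated F L x" and null: "weakly_null F L x"
    and k: "k \<ge> 1" and "\<epsilon> > 0"
  obtains T where "\<And>j. j \<in> {1..k} \<Longrightarrow> \<exists>y\<in>convex hull (x ` T j). norm y < \<epsilon>"
    "\<And>n \<kappa> a s. 1 \<le> n \<Longrightarrow> \<kappa> ` {1..n} \<subseteq> {1..k} \<Longrightarrow> strict_mono_on {1..n} \<kappa> \<Longrightarrow>
      \<forall>j\<in>{1..n}. \<bar>a j\<bar> \<le> 1 \<Longrightarrow> s \<in> Pi {1..k} T \<Longrightarrow>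
      \<bar>norm (\<Sum>j=1..n. a j *\<^sub>R x (s (\<kappa> j))) - p (\<Sum>j=1..n. a j *\<^sub>R e j)\<bar> < \<epsilon>"
proof -
  obtain \<delta> :: "nat \<Rightarrow> real" where "\<delta> \<longlonglongrightarrow> 0" and \<delta>: "\<And>l n a s. l \<ge> 1 \<Longrightarrow> n \<in> {1..l} \<Longrightarrow> s \<in> Plm n (restr F L) \<Longrightarrow>
      (\<forall>j\<in>{1..n}. a j \<in> {-1..1}) \<Longrightarrow> elt (s 1) 1 \<ge> elt L l \<Longrightarrow>
      \<bar>norm (\<Sum>j=1..n. a j *\<^sub>R x (s j)) - p (\<Sum>j=1..n. a j *\<^sub>R e j)\<bar> \<le> \<delta> l"
    using gen unfolding generates_spreading_model_def by blast
  have "\<forall>\<^sub>F l in sequentially. \<delta> l < \<epsilon> \<and> k \<le> l"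
    by (intro eventually_conj order_tendstoD(2)[OF \<open>\<delta> \<longlonglongrightarrow> 0\<close>] eventually_ge_at_top \<open>\<epsilon> > 0\<close>)
  then obtain l where l: "\<delta> l < \<epsilon>" "k \<le> l" by (auto simp: eventually_sequentially)
  obtain T where T: "\<And>j. j \<in> {1..k} \<Longrightarrow> T j \<subseteq> restr F L"
    "\<And>j. j \<in> {1..k} \<Longrightarrow> \<exists>y\<in>convex hull (x ` T j). norm y < \<epsilon>"
    "\<And>s. s \<in> Pi {1..k} T \<Longrightarrow> plegma k s"
    "\<And>j s y. j \<in> {1..k} \<Longrightarrow> s \<in> T j \<Longrightarrow> y \<in> s \<Longrightarrow> elt L l < y"
    by (rule exists_interleaved_sets[OF F L sub null k \<open>\<epsilon> > 0\<close>, of "elt L l"]) (rule that)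
  show ?thesis
  proof (rule that[OF T(2)])
    fix n \<kappa> and a :: "nat \<Rightarrow> real" and s
    assume n: "1 \<le> n" and \<kappa>: "\<kappa> ` {1..n} \<subseteq> {1..k}" "strict_mono_on {1..n} \<kappa>"
      and a: "\<forall>j\<in>{1..n}. \<bar>a j\<bar> \<le> 1" and s: "s \<in> Pi {1..k} T"
    let ?s = "\<lambda>j\<in>{1..n}. s (\<kappa> j)"
    have mem: "s (\<kappa> j) \<in> restr F L" if "j \<in> {1..n}" for j
      using \<kappa>(1) T(1) Pi_mem[OF s] that by blast
    have plm: "plegma n ?s" by (rule plegma_subfamily[OF T(3)[OF s] \<kappa>])
    then have "?s \<in> Plm n (restr F L)" using mem by (simp add: Plm_def)
    moreover have "n \<in> {1..l}"
    proof -
      have "card (\<kappa> ` {1..n}) = n" using card_image[OF strict_mono_on_imp_inj_on[OF \<kappa>(2)]] by simp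
      then show ?thesis using card_mono[OF _ \<kappa>(1)] l(2) n by simp
    qed
    moreover have "elt L l \<le> elt (?s 1) 1"
    proof -
      have "1 \<in> {1..n}" using n by simp
      then have 1: "\<kappa> 1 \<in> {1..k}" using \<kappa>(1) by blast
      have "finite (s (\<kappa> 1))" "s (\<kappa> 1) \<noteq> {}"
        using plm n by (auto simp: plegma_def fin_subsets_def)
      then have "elt (s (\<kappa> 1)) (Suc 0) \<in> s (\<kappa> 1)" by (intro elt_mem) (auto simp: card_gt_0_iff)
      then show ?thesis using T(4)[OF 1 Pi_mem[OF s 1]] n by (auto intro: less_imp_le)
    qed
    moreover have "\<forall>j\<in>{1..n}. a j \<in> {-1..1}" using a by (auto simp: abs_le_iff)
    ultimately have "\<bar>norm (\<Sum>j=1..n. a j *\<^sub>R x (?s j)) - p (\<Sum>j=1..n. a j *\<^sub>R e j)\<bar> \<le> \<delta> l"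
      by (intro \<delta>) (assumption | use k l(2) in linarith)+
    moreover have "(\<Sum>j=1..n. a j *\<^sub>R x (?s j)) = (\<Sum>j=1..n. a j *\<^sub>R x (s (\<kappa> j)))"
      by (rule sum.cong) auto
    ultimately show "\<bar>norm (\<Sum>j=1..n. a j *\<^sub>R x (s (\<kappa> j))) - p (\<Sum>j=1..n. a j *\<^sub>R e j)\<bar> < \<epsilon>"
      using l(1) by simp
  qed
qed

text \<open>The spreading model estimates are for coefficients in \<open>[-1, 1]\<close>; general ones are rescaled.\<close>

lemma ex_normalizing_scalar:
  fixes a :: "nat \<Rightarrow> real"
  obtains c where "c > 0" "\<And>j. j \<in> {1..n} \<Longrightarrow> \<bar>c * a j\<bar> \<le> 1"
proof -
  define S where "S = 1 + (\<Sum>j=1..n. \<bar>a j\<bar>)"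
  have S: "S > 0" unfolding S_def by (rule add_pos_nonneg) (auto intro: sum_nonneg)
  have "\<bar>a j\<bar> \<le> S" if "j \<in> {1..n}" for j
    unfolding S_def using member_le_sum[of j "{1..n}" "\<lambda>j. \<bar>a j\<bar>"] that by simp
  then show ?thesis using S by (intro that[of "1 / S"]) (auto simp: abs_mult)
qed

lemma sum_extend_by_zero:
  fixes f :: "nat \<Rightarrow> 'b::real_vector"
  assumes "inj_on \<kappa> {1..n}" "\<kappa> ` {1..n} \<subseteq> {1..k::nat}"
  shows "(\<Sum>i=1..k. (if i \<in> \<kappa> ` {1..n} then a (the_inv_into {1..n} \<kappa> i) else 0) *\<^sub>R f i) =
    (\<Sum>j=1..n. a j *\<^sub>R f (\<kappa> j))"
proof -
  have "(\<Sum>i=1..k. (if i \<in> \<kappa> ` {1..n} then a (the_inv_into {1..n} \<kappa> i) else 0) *\<^sub>R f i) =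
    (\<Sum>i\<in>\<kappa> ` {1..n}. a (the_inv_into {1..n} \<kappa> i) *\<^sub>R f i)"
    by (rule sum.mono_neutral_cong_right) (use assms(2) in auto)
  also have "\<dots> = (\<Sum>j=1..n. a j *\<^sub>R f (\<kappa> j))"
    by (subst sum.reindex[OF assms(1)]) (auto intro!: sum.cong simp: the_inv_into_f_f[OF assms(1)])
  finally show ?thesis .
qed

locale generated_model =
  fixes F :: "nat set set" and L :: "nat set"
    and x :: "nat set \<Rightarrow> 'a::real_normed_vector"
    and p :: "'e::real_vector \<Rightarrow> real" and e :: "nat \<Rightarrow> 'e"
  assumes F: "regular_thin F" "F \<noteq> {{}}" and L: "L \<in> inf_subsets PNat"
    and gen: "generates_spreading_model F L x p e"
    and sub: "subordinated F L x" and null: "weakly_null F L x"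
begin

lemma p_scale: "c > 0 \<Longrightarrow> p (\<Sum>j\<in>A. (c * b j) *\<^sub>R f j) = c * p (\<Sum>j\<in>A. b j *\<^sub>R f j)"
  using gen by (simp add: generates_spreading_model_def seminorm_def scaleR_sum_right[symmetric]
      scaleR_scaleR[symmetric] del: scaleR_scaleR)

text \<open>Take a plegma family of length \<open>k = \<kappa> n\<close>. The norm of \<open>\<Sum>j. a j x (s (\<kappa> j))\<close> approximates the
  left-hand side through the subfamily \<open>s \<circ> \<kappa>\<close> and the right-hand side through the whole family with
  coefficients extended by zero.\<close>

lemma model_spreading: "spreading_sequence p e"
  unfolding spreading_sequence_def
proof (intro allI impI, elim conjE)
  fix n :: nat and \<kappa> :: "nat \<Rightarrow> nat" and a :: "nat \<Rightarrow> real"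
  assume n: "1 \<le> n" and \<kappa>: "\<kappa> ` {1..n} \<subseteq> PNat" "strict_mono_on {1..n} \<kappa>"
  obtain c where c: "c > 0" "\<And>j. j \<in> {1..n} \<Longrightarrow> \<bar>c * a j\<bar> \<le> 1" by (rule ex_normalizing_scalar[of n a]) (rule that)
  define k where "k = \<kappa> n"
  have ran: "\<kappa> ` {1..n} \<subseteq> {1..k}"
  proof
    fix i assume i: "i \<in> \<kappa> ` {1..n}"
    then obtain j where j: "j \<in> {1..n}" "i = \<kappa> j" by blast
    then have "\<kappa> j \<le> k" unfolding k_def
      using strict_mono_onD[OF \<kappa>(2), of j n] n by (cases "j = n") auto
    moreover have "1 \<le> i" using \<kappa>(1) i by (auto simp: PNat_def)
    ultimately show "i \<in> {1..k}" using j by simp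
  qed
  moreover have "n \<in> {1..n}" using n by simp
  ultimately have "k \<in> {1..k}" unfolding k_def by blast
  then have k: "k \<ge> 1" by simp
  have inj: "inj_on \<kappa> {1..n}" using \<kappa>(2) by (rule strict_mono_on_imp_inj_on)
  let ?b = "\<lambda>i. if i \<in> \<kappa> ` {1..n} then c * a (the_inv_into {1..n} \<kappa> i) else 0"
  have b: "\<bar>?b i\<bar> \<le> 1" for i
  proof (cases "i \<in> \<kappa> ` {1..n}")
    case True
    then obtain j where "j \<in> {1..n}" "i = \<kappa> j" by blast
    then have "the_inv_into {1..n} \<kappa> i = j" by (simp only: the_inv_into_f_f[OF inj])
    then show ?thesis using c(2)[OF \<open>j \<in> {1..n}\<close>] by simp
  qed simp
  let ?u = "p (\<Sum>j=1..n. (c * a j) *\<^sub>R e j)" and ?v = "p (\<Sum>j=1..n. (c * a j) *\<^sub>R e (\<kappa> j))"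
  have "\<bar>?u - ?v\<bar> < \<epsilon>" if "\<epsilon> > 0" for \<epsilon>
  proof -
    have pos: "\<epsilon> / 2 > 0" using that by simp
    obtain T where T: "\<And>j. j \<in> {1..k} \<Longrightarrow> \<exists>y\<in>convex hull (x ` T j). norm y < \<epsilon> / 2"
      and appr: "\<And>n \<kappa> a s. 1 \<le> n \<Longrightarrow> \<kappa> ` {1..n} \<subseteq> {1..k} \<Longrightarrow> strict_mono_on {1..n} \<kappa> \<Longrightarrow>
      \<forall>j\<in>{1..n}. \<bar>a j\<bar> \<le> 1 \<Longrightarrow> s \<in> Pi {1..k} T \<Longrightarrow>
      \<bar>norm (\<Sum>j=1..n. a j *\<^sub>R x (s (\<kappa> j))) - p (\<Sum>j=1..n. a j *\<^sub>R e j)\<bar> < \<epsilon> / 2"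
      by (rule interleaved_sets_approximate_model[OF F L gen sub null k pos]) (rule that)
    have "T j \<noteq> {}" if "j \<in> {1..k}" for j using T[OF that] by auto
    then have "\<forall>j\<in>{1..k}. \<exists>s. s \<in> T j" by blast
    then obtain s where s: "s \<in> Pi {1..k} T" using Pi_iff by metis
    let ?w = "norm (\<Sum>j=1..n. (c * a j) *\<^sub>R x (s (\<kappa> j)))"
    have "\<bar>?w - ?u\<bar> < \<epsilon> / 2" by (rule appr[OF n ran \<kappa>(2) _ s]) (use c(2) in blast)
    moreover have "\<bar>norm (\<Sum>i=1..k. ?b i *\<^sub>R x (s i)) - p (\<Sum>i=1..k. ?b i *\<^sub>R e i)\<bar> < \<epsilon> / 2"
      using appr[OF k, of "\<lambda>i. i" ?b s] b s by (simp add: strict_mono_on_def)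
    then have "\<bar>?w - ?v\<bar> < \<epsilon> / 2" unfolding sum_extend_by_zero[OF inj ran, of "\<lambda>j. c * a j"] .
    ultimately show ?thesis by linarith
  qed
  then have "?u - ?v = 0" by (intro dense_eq0_I less_imp_le)
  then have "?u = ?v" by simp
  then show "p (\<Sum>j=1..n. a j *\<^sub>R e j) = p (\<Sum>j=1..n. a j *\<^sub>R e (\<kappa> j))"
    using c(1) by (simp add: p_scale)
qed

text \<open>The averaging argument: the other sets of the plegma family stay fixed while the one at
  position \<open>q\<close> runs through \<open>T q\<close>, and a convex combination of the values there is almost \<open>0\<close>.\<close>

lemma delete_coordinate:
  assumes q: "q \<in> {1..m}"
  shows "p (\<Sum>n=1..m. (a(q := 0)) n *\<^sub>R e n) \<le> p (\<Sum>n=1..m. a n *\<^sub>R e n)"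
proof -
  obtain c where c: "c > 0" "\<And>j. j \<in> {1..m} \<Longrightarrow> \<bar>c * a j\<bar> \<le> 1" by (rule ex_normalizing_scalar[of m a]) (rule that)
  define b where "b = (\<lambda>j. c * a j)"
  have m: "m \<ge> 1" using q by simp
  let ?u = "p (\<Sum>n=1..m. (b(q := 0)) n *\<^sub>R e n)" and ?v = "p (\<Sum>n=1..m. b n *\<^sub>R e n)"
  have "?u \<le> ?v + \<epsilon>" if "\<epsilon> > 0" for \<epsilon>
  proof -
    have pos: "\<epsilon> / 3 > 0" using that by simp
    obtain T where T: "\<And>j. j \<in> {1..m} \<Longrightarrow> \<exists>y\<in>convex hull (x ` T j). norm y < \<epsilon> / 3"
      and appr': "\<And>n \<kappa> a s. 1 \<le> n \<Longrightarrow> \<kappa> ` {1..n} \<subseteq> {1..m} \<Longrightarrow> strict_mono_on {1..n} \<kappa> \<Longrightarrow>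
      \<forall>j\<in>{1..n}. \<bar>a j\<bar> \<le> 1 \<Longrightarrow> s \<in> Pi {1..m} T \<Longrightarrow>
      \<bar>norm (\<Sum>j=1..n. a j *\<^sub>R x (s (\<kappa> j))) - p (\<Sum>j=1..n. a j *\<^sub>R e j)\<bar> < \<epsilon> / 3"
      by (rule interleaved_sets_approximate_model[OF F L gen sub null m pos]) (rule that)
    have appr: "\<bar>norm (\<Sum>j=1..m. a j *\<^sub>R x (s j)) - p (\<Sum>j=1..m. a j *\<^sub>R e j)\<bar> < \<epsilon> / 3"
      if "\<forall>j\<in>{1..m}. \<bar>a j\<bar> \<le> 1" "s \<in> Pi {1..m} T" for a s
      using appr'[OF m, of "\<lambda>i. i" a s] that by (simp add: strict_mono_on_def)
    have "T j \<noteq> {}" if "j \<in> {1..m}" for j using T[OF that] by auto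
    then have "\<forall>j\<in>{1..m}. \<exists>s. s \<in> T j" by blast
    then obtain s where s: "s \<in> Pi {1..m} T" using Pi_iff by metis
    have b: "\<bar>b j\<bar> \<le> 1" if "j \<in> {1..m}" for j using c(2)[OF that] by (simp add: b_def)
    define z where "z = (\<Sum>j\<in>{1..m} - {q}. b j *\<^sub>R x (s j))"
    have "\<bar>norm (\<Sum>j=1..m. (b(q := 0)) j *\<^sub>R x (s j)) - ?u\<bar> < \<epsilon> / 3"
      by (rule appr) (use b s in auto)
    moreover have "(\<Sum>j=1..m. (b(q := 0)) j *\<^sub>R x (s j)) = z"
      unfolding z_def by (rule sum.mono_neutral_cong_right) auto
    ultimately have "\<bar>norm z - ?u\<bar> < \<epsilon> / 3" by (simp only:)
    then have low: "?u < norm z + \<epsilon> / 3" by linarith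
    \<comment> \<open>A convex set that contains \<open>x ` T q\<close>, hence also the small vector of its hull.\<close>
    define C where "C = {w. norm (z + b q *\<^sub>R w) \<le> ?v + \<epsilon> / 3}"
    have "x t \<in> C" if t: "t \<in> T q" for t
    proof -
      have "\<bar>norm (\<Sum>j=1..m. b j *\<^sub>R x ((s(q := t)) j)) - ?v\<bar> < \<epsilon> / 3"
        by (rule appr) (use b s t in auto)
      moreover have "(\<Sum>j=1..m. b j *\<^sub>R x ((s(q := t)) j)) = b q *\<^sub>R x t + z"
      proof -
        have "(\<Sum>j\<in>{1..m} - {q}. b j *\<^sub>R x ((s(q := t)) j)) = z"
          unfolding z_def by (rule sum.cong) simp_all
        then show ?thesis
          using sum.remove[OF finite_atLeastAtMost q, of "\<lambda>j. b j *\<^sub>R x ((s(q := t)) j)"] by simp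
      qed
      ultimately have "\<bar>norm (b q *\<^sub>R x t + z) - ?v\<bar> < \<epsilon> / 3" by (simp only:)
      then have "norm (z + b q *\<^sub>R x t) \<le> ?v + \<epsilon> / 3" unfolding add.commute[of z] by linarith
      then show ?thesis unfolding C_def by blast
    qed
    moreover have "convex C"
    proof -
      have "dist (- z) w = norm (z + w)" for w
        unfolding dist_norm using norm_minus_cancel[of "z + w"] by (simp del: norm_minus_cancel)
      then have "C = (\<lambda>w. b q *\<^sub>R w) -` cball (- z) (?v + \<epsilon> / 3)"
        unfolding C_def vimage_def mem_cball by (simp only:)
      moreover have "linear (\<lambda>w :: 'a. b q *\<^sub>R w)" by (rule linear_scaleR)
      ultimately show ?thesis by (simp only: convex_linear_vimage convex_cball)
    qed
    ultimately have "convex hull (x ` T q) \<subseteq> C" by (intro hull_minimal) auto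
    then obtain y where y: "y \<in> C" "norm y < \<epsilon> / 3" using T[OF q] by blast
    have "norm z \<le> norm (z + b q *\<^sub>R y) + norm (b q *\<^sub>R y)"
      using norm_triangle_ineq4[of "z + b q *\<^sub>R y" "b q *\<^sub>R y"] by simp
    also have "norm (b q *\<^sub>R y) \<le> 1 * norm y" unfolding norm_scaleR
      by (rule mult_right_mono) (use b[OF q] in auto)
    finally have "norm z \<le> norm (z + b q *\<^sub>R y) + norm y" by simp
    moreover have "norm (z + b q *\<^sub>R y) \<le> ?v + \<epsilon> / 3" using y(1) unfolding C_def by blast
    ultimately show ?thesis using low y(2) by linarith
  qed
  then have "?u \<le> ?v" by (rule field_le_epsilon)
  moreover have "(b(q := 0)) n = c * (a(q := 0)) n" for n by (simp add: b_def)
  then have "?u = c * p (\<Sum>n=1..m. (a(q := 0)) n *\<^sub>R e n)" by (simp only: p_scale[OF c(1)])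
  moreover have "?v = c * p (\<Sum>n=1..m. a n *\<^sub>R e n)" by (simp only: b_def p_scale[OF c(1)])
  ultimately show ?thesis using c(1) by simp
qed

lemma model_unconditional: "unconditional 1 p e"
  unfolding unconditional_def
proof (intro allI impI)
  fix m :: nat and A :: "nat set" and a :: "nat \<Rightarrow> real"
  assume A: "A \<subseteq> {1..m}"
  have del: "p (\<Sum>n=1..m. (if n \<in> D then 0 else a n) *\<^sub>R e n) \<le> p (\<Sum>n=1..m. a n *\<^sub>R e n)"
    if "finite D" "D \<subseteq> {1..m}" for D
    using that
  proof (induction D)
    case (insert q D)
    have "(if n \<in> insert q D then 0 else a n) = ((\<lambda>n. if n \<in> D then 0 else a n)(q := 0)) n" for n
      by simp
    then have "p (\<Sum>n=1..m. (if n \<in> insert q D then 0 else a n) *\<^sub>R e n)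
        \<le> p (\<Sum>n=1..m. (if n \<in> D then 0 else a n) *\<^sub>R e n)"
      using delete_coordinate[of q m "\<lambda>n. if n \<in> D then 0 else a n"] insert.prems by (simp only: insert_subset)
    moreover have "p (\<Sum>n=1..m. (if n \<in> D then 0 else a n) *\<^sub>R e n) \<le> p (\<Sum>n=1..m. a n *\<^sub>R e n)"
      using insert.IH insert.prems by blast
    ultimately show ?case by (rule order_trans)
  qed simp
  have "(\<Sum>n\<in>A. a n *\<^sub>R e n) = (\<Sum>n=1..m. (if n \<in> {1..m} - A then 0 else a n) *\<^sub>R e n)"
    by (rule sum.mono_neutral_cong_left) (use A in auto)
  then show "p (\<Sum>n\<in>A. a n *\<^sub>R e n) \<le> 1 * p (\<Sum>n=1..m. a n *\<^sub>R e n)"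
    using del[of "{1..m} - A"] by simp
qed

end

theorem theorem6p9:
  fixes F :: "nat set set" and L :: "nat set"
    and x :: "nat set \<Rightarrow> 'a::banach"
    and p :: "'e::real_vector \<Rightarrow> real" and e :: "nat \<Rightarrow> 'e"
  assumes "regular_thin F" and "F \<noteq> {{}}"
    and "L \<in> inf_subsets PNat"
    and "generates_spreading_model F L x p e"
    and "seminormalized F L x"
    and "subordinated F L x"
    and "weakly_null F L x"
  shows "spreading_sequence p e \<and> unconditional 1 p e"
proof -
  interpret generated_model F L x p e
    by unfold_locales (use assms in auto)
  show ?thesis using model_spreading model_unconditional by blast
qed
end
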